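(* The finite version of Brown's lemma is provable in $\mathsf{RCA}_0$; that is, $\mathsf{RCA}_0$ proves: for every $f\colon\mathbb{N}\to\mathbb{N}$ and every $r>0$ there exists $n$ such that every coloring $C\colon n\to r$ has a $C$-homogeneous set $H$ with $|H|>f(\mathrm{gs}(H))$.
   Context: $\mathsf{RCA}_0$ is the system of second-order arithmetic consisting of the usual basic axioms for addition and multiplication, together with $\Sigma^0_1$-induction and $\Delta^0_1$-comprehension. A natural number $n$ is identified with $\{0,\dots,n-1\}$. For a coloring $C\colon n\to r$, a set $H\subseteq n$ is $C$-homogeneous if $C$ is constant on $H$. For a finite set $H\subseteq\mathbb{N}$, the gap size $\mathrm{gs}(H)$ is the largest difference between two consecutive elements of $H$; if $|H|\leq 1$, $\mathrm{gs}(H)=1$. *)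

theory Defs
  imports Main
begin

section \<open>The language of second-order arithmetic\<close>

text \<open>
  Two-sorted first-order logic with equality between numbers only. Number variables and set
  variables are de Bruijn indices in two separate name spaces: \<open>AllN\<close> binds number index 0 and
  leaves set indices alone, \<open>AllS\<close> binds set index 0 and leaves number indices alone.
\<close>

datatype tm = Var nat | Zero | One | Add tm tm | Mul tm tm

datatype fm =
    Eq tm tm
  | Less tm tm
  | Mem tm nat  \<comment> \<open>the second argument is a set variable\<close>
  | Bot
  | Imp fm fm
  | AllN fm
  | AllS fm

abbreviation Neg :: "fm \<Rightarrow> fm" where "Neg \<phi> \<equiv> Imp \<phi> Bot"
abbreviation And :: "fm \<Rightarrow> fm \<Rightarrow> fm" where "And \<phi> \<psi> \<equiv> Neg (Imp \<phi> (Neg \<psi>))"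
abbreviation Or :: "fm \<Rightarrow> fm \<Rightarrow> fm" where "Or \<phi> \<psi> \<equiv> Imp (Neg \<phi>) \<psi>"
abbreviation Iff :: "fm \<Rightarrow> fm \<Rightarrow> fm" where "Iff \<phi> \<psi> \<equiv> And (Imp \<phi> \<psi>) (Imp \<psi> \<phi>)"
abbreviation ExN :: "fm \<Rightarrow> fm" where "ExN \<phi> \<equiv> Neg (AllN (Neg \<phi>))"
abbreviation ExS :: "fm \<Rightarrow> fm" where "ExS \<phi> \<equiv> Neg (AllS (Neg \<phi>))"
abbreviation Le :: "tm \<Rightarrow> tm \<Rightarrow> fm" where "Le s t \<equiv> Or (Less s t) (Eq s t)"

primrec subst_tm :: "(nat \<Rightarrow> tm) \<Rightarrow> tm \<Rightarrow> tm" where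
  "subst_tm \<sigma> (Var i) = \<sigma> i"
| "subst_tm \<sigma> Zero = Zero"
| "subst_tm \<sigma> One = One"
| "subst_tm \<sigma> (Add s t) = Add (subst_tm \<sigma> s) (subst_tm \<sigma> t)"
| "subst_tm \<sigma> (Mul s t) = Mul (subst_tm \<sigma> s) (subst_tm \<sigma> t)"

definition shift_tm :: "nat \<Rightarrow> tm \<Rightarrow> tm" where
  "shift_tm k = subst_tm (\<lambda>i. Var (i + k))"

text \<open>
  Simultaneous capture-avoiding substitution of terms (by \<open>\<sigma>\<close>) for the free number variables and of
  set variables (by \<open>\<rho>\<close>) for the free set variables.
\<close>

primrec subst :: "(nat \<Rightarrow> tm) \<Rightarrow> (nat \<Rightarrow> nat) \<Rightarrow> fm \<Rightarrow> fm" where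
  "subst \<sigma> \<rho> (Eq s t) = Eq (subst_tm \<sigma> s) (subst_tm \<sigma> t)"
| "subst \<sigma> \<rho> (Less s t) = Less (subst_tm \<sigma> s) (subst_tm \<sigma> t)"
| "subst \<sigma> \<rho> (Mem t X) = Mem (subst_tm \<sigma> t) (\<rho> X)"
| "subst \<sigma> \<rho> Bot = Bot"
| "subst \<sigma> \<rho> (Imp \<phi> \<psi>) = Imp (subst \<sigma> \<rho> \<phi>) (subst \<sigma> \<rho> \<psi>)"
| "subst \<sigma> \<rho> (AllN \<phi>) = AllN (subst (case_nat (Var 0) (\<lambda>i. shift_tm 1 (\<sigma> i))) \<rho> \<phi>)"
| "subst \<sigma> \<rho> (AllS \<phi>) = AllS (subst \<sigma> (case_nat 0 (\<lambda>X. Suc (\<rho> X))) \<phi>)"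

definition shiftN :: "fm \<Rightarrow> fm" where "shiftN = subst (\<lambda>i. Var (Suc i)) id"
definition shiftS :: "fm \<Rightarrow> fm" where "shiftS = subst Var Suc"
definition instN :: "tm \<Rightarrow> fm \<Rightarrow> fm" where "instN t = subst (case_nat t Var) id"
definition instS :: "nat \<Rightarrow> fm \<Rightarrow> fm" where "instS X = subst Var (case_nat X id)"

primrec bounded_tm :: "nat \<Rightarrow> tm \<Rightarrow> bool" where
  "bounded_tm k (Var i) \<longleftrightarrow> i < k"
| "bounded_tm k Zero \<longleftrightarrow> True"
| "bounded_tm k One \<longleftrightarrow> True"
| "bounded_tm k (Add s t) \<longleftrightarrow> bounded_tm k s \<and> bounded_tm k t"
| "bounded_tm k (Mul s t) \<longleftrightarrow> bounded_tm k s \<and> bounded_tm k t"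

text \<open>\<open>free_below k l \<phi>\<close>: free number variables are below \<open>k\<close>, free set variables below \<open>l\<close>.\<close>

primrec free_below :: "nat \<Rightarrow> nat \<Rightarrow> fm \<Rightarrow> bool" where
  "free_below k l (Eq s t) \<longleftrightarrow> bounded_tm k s \<and> bounded_tm k t"
| "free_below k l (Less s t) \<longleftrightarrow> bounded_tm k s \<and> bounded_tm k t"
| "free_below k l (Mem t X) \<longleftrightarrow> bounded_tm k t \<and> X < l"
| "free_below k l Bot \<longleftrightarrow> True"
| "free_below k l (Imp \<phi> \<psi>) \<longleftrightarrow> free_below k l \<phi> \<and> free_below k l \<psi>"
| "free_below k l (AllN \<phi>) \<longleftrightarrow> free_below (Suc k) l \<phi>"
| "free_below k l (AllS \<phi>) \<longleftrightarrow> free_below k (Suc l) \<phi>"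

section \<open>Classical natural deduction\<close>

text \<open>
  Shifting the hypotheses in the quantifier introduction rules is the eigenvariable condition:
  index 0 does not occur free in a shifted hypothesis.
\<close>

inductive provable :: "fm set \<Rightarrow> fm \<Rightarrow> bool" (infix "\<turnstile>" 50) where
  Assm: "\<phi> \<in> \<Gamma> \<Longrightarrow> \<Gamma> \<turnstile> \<phi>"
| ImpI: "insert \<phi> \<Gamma> \<turnstile> \<psi> \<Longrightarrow> \<Gamma> \<turnstile> Imp \<phi> \<psi>"
| ImpE: "\<Gamma> \<turnstile> Imp \<phi> \<psi> \<Longrightarrow> \<Gamma> \<turnstile> \<phi> \<Longrightarrow> \<Gamma> \<turnstile> \<psi>"
| Contr: "insert (Neg \<phi>) \<Gamma> \<turnstile> Bot \<Longrightarrow> \<Gamma> \<turnstile> \<phi>"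
| AllNI: "shiftN ` \<Gamma> \<turnstile> \<phi> \<Longrightarrow> \<Gamma> \<turnstile> AllN \<phi>"
| AllNE: "\<Gamma> \<turnstile> AllN \<phi> \<Longrightarrow> \<Gamma> \<turnstile> instN t \<phi>"
| AllSI: "shiftS ` \<Gamma> \<turnstile> \<phi> \<Longrightarrow> \<Gamma> \<turnstile> AllS \<phi>"
| AllSE: "\<Gamma> \<turnstile> AllS \<phi> \<Longrightarrow> \<Gamma> \<turnstile> instS X \<phi>"
| EqI: "\<Gamma> \<turnstile> Eq t t"
| EqE: "\<Gamma> \<turnstile> Eq s t \<Longrightarrow> \<Gamma> \<turnstile> instN s \<phi> \<Longrightarrow> \<Gamma> \<turnstile> instN t \<phi>"

section \<open>The system RCA0\<close>

text \<open>In a bounded quantifier \<open>\<forall>x < t\<close> the bound \<open>t\<close> must not contain \<open>x\<close>, hence the shift. Bounded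
  existential quantifiers are obtained from \<open>BAll\<close> by negation.\<close>

inductive Delta00 :: "fm \<Rightarrow> bool" where
  "Delta00 (Eq s t)"
| "Delta00 (Less s t)"
| "Delta00 (Mem t X)"
| "Delta00 Bot"
| "Delta00 \<phi> \<Longrightarrow> Delta00 \<psi> \<Longrightarrow> Delta00 (Imp \<phi> \<psi>)"
| BAll: "Delta00 \<phi> \<Longrightarrow> Delta00 (AllN (Imp (Less (Var 0) (shift_tm 1 t)) \<phi>))"

definition Sigma01 :: "fm \<Rightarrow> bool" where
  "Sigma01 \<phi> \<longleftrightarrow> (\<exists>\<theta>. Delta00 \<theta> \<and> \<phi> = ExN \<theta>)"

definition Pi01 :: "fm \<Rightarrow> bool" where
  "Pi01 \<phi> \<longleftrightarrow> (\<exists>\<theta>. Delta00 \<theta> \<and> \<phi> = AllN \<theta>)"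

definition basic_axioms :: "fm set" where
  "basic_axioms = (let m = Var 0; n = Var 1 in
    { Neg (Eq (Add n One) Zero),
      Imp (Eq (Add m One) (Add n One)) (Eq m n),
      Eq (Add m Zero) m,
      Eq (Add m (Add n One)) (Add (Add m n) One),
      Eq (Mul m Zero) Zero,
      Eq (Mul m (Add n One)) (Add (Mul m n) m),
      Neg (Less m Zero),
      Iff (Less m (Add n One)) (Or (Less m n) (Eq m n)) })"

text \<open>In both schemes number index 0 of \<open>\<phi>\<close> (and of \<open>\<psi>\<close>) is the displayed variable \<open>n\<close>; all other
  free variables are parameters.\<close>

definition induction_axiom :: "fm \<Rightarrow> fm" where
  "induction_axiom \<phi> =
    Imp (And (instN Zero \<phi>)
             (AllN (Imp \<phi> (subst (case_nat (Add (Var 0) One) (\<lambda>i. Var (Suc i))) id \<phi>))))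
        (AllN \<phi>)"

definition comprehension_axiom :: "fm \<Rightarrow> fm \<Rightarrow> fm" where
  "comprehension_axiom \<phi> \<psi> =
    Imp (AllN (Iff \<phi> \<psi>)) (ExS (AllN (Iff (Mem (Var 0) 0) (shiftS \<phi>))))"

definition RCA0_axioms :: "fm set" where
  "RCA0_axioms = basic_axioms
    \<union> {induction_axiom \<phi> | \<phi>. Sigma01 \<phi>}
    \<union> {comprehension_axiom \<phi> \<psi> | \<phi> \<psi>. Sigma01 \<phi> \<and> Pi01 \<psi>}"

text \<open>The theory consists of the universal closures of the axioms.\<close>

definition RCA0 :: "fm set" where
  "RCA0 = {(AllN ^^ k) ((AllS ^^ l) \<phi>) | k l \<phi>. \<phi> \<in> RCA0_axioms \<and> free_below k l \<phi>}"

section \<open>The finite version of Brown's lemma\<close>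

text \<open>The usual coding \<open>(s + t)\<^sup>2 + s\<close> of pairs in second-order arithmetic.\<close>

definition pair :: "tm \<Rightarrow> tm \<Rightarrow> tm" where
  "pair s t = Add (Mul (Add s t) (Add s t)) s"

text \<open>
  A class \<open>{x. A(x)}\<close> is represented by a formula \<open>A\<close> whose number index 0 is \<open>x\<close>. The formula
  \<open>in_class k s A\<close> says that \<open>s\<close> belongs to \<open>A\<close>; it is used \<open>k\<close> number binders below the context of \<open>A\<close>.
\<close>

definition in_class :: "nat \<Rightarrow> tm \<Rightarrow> fm \<Rightarrow> fm" where
  "in_class k s A = subst (case_nat s (\<lambda>i. Var (i + k))) id A"

definition all_numbers :: fm where "all_numbers = Eq (Var 0) (Var 0)"
definition below :: "tm \<Rightarrow> fm" where "below t = Less (Var 0) (shift_tm 1 t)"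
definition elements :: "nat \<Rightarrow> fm" where "elements X = Mem (Var 0) X"

text \<open>\<open>F : A \<rightarrow> B\<close>, i.e. \<open>F\<close> is a set of pairs included in \<open>A \<times> B\<close>, single-valued, and total on \<open>A\<close>.\<close>

definition is_function :: "nat \<Rightarrow> fm \<Rightarrow> fm \<Rightarrow> fm" where
  "is_function F A B =
    And (AllN (Imp (Mem (Var 0) F)
           (ExN (ExN (And (And (in_class 3 (Var 1) A) (in_class 3 (Var 0) B))
                          (Eq (pair (Var 1) (Var 0)) (Var 2)))))))
   (And (AllN (AllN (AllN (Imp (And (Mem (pair (Var 2) (Var 1)) F) (Mem (pair (Var 2) (Var 0)) F))
                               (Eq (Var 1) (Var 0))))))
        (AllN (Imp (in_class 1 (Var 0) A) (ExN (Mem (pair (Var 1) (Var 0)) F)))))"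

text \<open>\<open>|H| = c\<close>: there is a bijection from \<open>{0, \<dots>, c - 1}\<close> onto \<open>H\<close>.\<close>

definition card_is :: "nat \<Rightarrow> tm \<Rightarrow> fm" where
  "card_is H c = ExS (
    And (is_function 0 (below c) (elements (Suc H)))
   (And (AllN (AllN (AllN (Imp (And (Mem (pair (Var 2) (Var 0)) 0) (Mem (pair (Var 1) (Var 0)) 0))
                               (Eq (Var 2) (Var 1))))))
        (AllN (Imp (Mem (Var 0) (Suc H)) (ExN (Mem (pair (Var 0) (Var 1)) 0))))))"

text \<open>\<open>a < b\<close> are consecutive elements of \<open>H\<close>.\<close>

definition consecutive :: "nat \<Rightarrow> tm \<Rightarrow> tm \<Rightarrow> fm" where
  "consecutive H a b =
    And (And (Mem a H) (Mem b H))
   (And (Less a b)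
        (Neg (ExN (And (Mem (Var 0) H)
                       (And (Less (shift_tm 1 a) (Var 0)) (Less (Var 0) (shift_tm 1 b)))))))"

text \<open>\<open>gs(H) = g\<close>, for finite \<open>H\<close>.\<close>

definition gap_size_is :: "nat \<Rightarrow> tm \<Rightarrow> fm" where
  "gap_size_is H g =
    Or (And (ExN (And (card_is H (Var 0)) (Le (Var 0) One)))
            (Eq g One))
       (And (ExN (And (card_is H (Var 0)) (Less One (Var 0))))
       (And (ExN (ExN (And (consecutive H (Var 1) (Var 0))
                           (Eq (Var 0) (Add (Var 1) (shift_tm 2 g))))))
            (AllN (AllN (Imp (consecutive H (Var 1) (Var 0))
                             (Le (Var 0) (Add (Var 1) (shift_tm 2 g))))))))"

definition subset_below :: "nat \<Rightarrow> tm \<Rightarrow> fm" where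
  "subset_below H n = AllN (Imp (Mem (Var 0) H) (Less (Var 0) (shift_tm 1 n)))"

text \<open>\<open>C(x) = C(y)\<close> for all \<open>x, y \<in> H\<close>.\<close>

definition homogeneous :: "nat \<Rightarrow> nat \<Rightarrow> fm" where
  "homogeneous C H =
    AllN (AllN (AllN (AllN (
      Imp (And (And (Mem (Var 3) H) (Mem (Var 2) H))
               (And (Mem (pair (Var 3) (Var 1)) C) (Mem (pair (Var 2) (Var 0)) C)))
          (Eq (Var 1) (Var 0))))))"

text \<open>\<open>|H| > F(gs(H))\<close>; the bound variables are \<open>g = gs(H)\<close>, \<open>m = F(g)\<close> and \<open>c = |H|\<close>, in this order.\<close>

definition card_exceeds :: "nat \<Rightarrow> nat \<Rightarrow> fm" where
  "card_exceeds F H = (let g = Var 2; m = Var 1; c = Var 0 in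
    ExN (ExN (ExN (And (And (gap_size_is H g) (Mem (pair g m) F))
                       (And (card_is H c) (Less m c))))))"

text \<open>
  The quantifiers bind, in this order, the set \<open>F\<close> (a function \<open>\<nat> \<rightarrow> \<nat>\<close>), the numbers \<open>r\<close> and \<open>n\<close>, the
  set \<open>C\<close> (a colouring \<open>n \<rightarrow> r\<close>) and the set \<open>H\<close>. Thus \<open>F\<close> is set index 0, 1 and 2 in the scope of
  the first, second and third set quantifier.
\<close>

definition finite_Brown :: fm where
  "finite_Brown =
    AllS (Imp (is_function 0 all_numbers all_numbers)
      (AllN (Imp (Less Zero (Var 0))
        (ExN (let n = Var 0; r = Var 1 in
          AllS (Imp (is_function 0 (below n) (below r))
            (ExS (let H = 0; C = 1; F = 2 in
              And (subset_below H n)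
             (And (homogeneous C H)
                  (card_exceeds F H))))))))))"

end

theory Submission
  imports Defs "HOL-Library.Countable_Set"
begin

text \<open>
  The derivation is obtained from the completeness of the calculus: a sentence that is not derivable
  from \<^const>\<open>RCA0\<close> fails in some countable model (\<open>countermodel\<close>), by the construction of
  Henkin. Hence it suffices to prove the finite version of Brown's lemma in an arbitrary model of
  \<^const>\<open>RCA0\<close>. Such a model may be nonstandard, so every induction and every comprehension below is
  applied to an explicit formula of the right complexity.

  The combinatorial idea is a recursion on the number of colours. Let \<open>n\<^sub>0 = 1\<close> and
  \<open>n\<^sub>i\<^sub>+\<^sub>1 = n\<^sub>i K\<close>, where \<open>K\<close> exceeds \<open>f(x)\<close> for all \<open>x \<le> 2 n\<^sub>i\<close>. Consider an interval of length
  \<open>n\<^sub>i\<^sub>+\<^sub>1\<close> that uses the colours up to \<open>i\<close> only, and cut it into \<open>K\<close> blocks of length \<open>n\<^sub>i\<close>. If every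
  block contains the colour \<open>i\<close>, the first elements of this colour in the blocks form a homogeneous
  set with \<open>K\<close> elements and with gaps of at most \<open>2 n\<^sub>i\<close>, so \<open>K\<close> exceeds the value of \<open>f\<close> at its gap
  size. Otherwise an interval of length \<open>n\<^sub>i\<close> uses the colours below \<open>i\<close> only. This cannot go on
  forever, as an interval of length \<open>n\<^sub>0\<close> is not empty. So \<open>n\<^sub>r\<close> is as required for \<open>r\<close> colours.

  In a model the descent is an application of the least number principle (\<open>dense_colour\<close>) to
  intervals of any length rather than a recursion, with the blocks replaced by arbitrary subintervals.
  What remains is the existence of the sequence of the \<open>n\<^sub>i\<close> up to \<open>r\<close>, which is iterated along \<open>f\<close>:
  it is proved by \<^const>\<open>Sigma01\<close> induction on \<open>r\<close> (\<open>tower_exists\<close>). For this purpose finite sets are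
  coded by pairs of numbers through divisibility in the manner of Goedel (\<open>code_exists\<close>).
\<close>

section \<open>Substitution\<close>

(* In the clause for AllN, the numeral in shift_tm 1 is to survive simplification. *)
declare One_nat_def [simp del]

abbreviation lift_tms :: "(nat \<Rightarrow> tm) \<Rightarrow> nat \<Rightarrow> tm" where
  "lift_tms \<sigma> \<equiv> case_nat (Var 0) (\<lambda>i. shift_tm 1 (\<sigma> i))"

abbreviation lift_sets :: "(nat \<Rightarrow> nat) \<Rightarrow> nat \<Rightarrow> nat" where
  "lift_sets \<rho> \<equiv> case_nat 0 (\<lambda>X. Suc (\<rho> X))"

lemma subst_tm_subst_tm: "subst_tm \<sigma> (subst_tm \<tau> t) = subst_tm (\<lambda>i. subst_tm \<sigma> (\<tau> i)) t"
  by (induction t) auto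

lemma subst_tm_Var: "subst_tm Var t = t"
  by (induction t) auto

lemma shift_tm_1: "shift_tm 1 = subst_tm (\<lambda>i. Var (Suc i))"
  by (simp add: shift_tm_def fun_eq_iff One_nat_def)

lemma lift_shift: "subst_tm (lift_tms \<sigma>) (shift_tm 1 t) = shift_tm 1 (subst_tm \<sigma> t)"
  by (simp add: shift_tm_1 subst_tm_subst_tm)

lemma subst_subst:
  "subst \<sigma> \<rho> (subst \<tau> \<pi> \<phi>) = subst (\<lambda>i. subst_tm \<sigma> (\<tau> i)) (\<lambda>X. \<rho> (\<pi> X)) \<phi>"
proof (induction \<phi> arbitrary: \<sigma> \<rho> \<tau> \<pi>)
  case (AllN \<phi>)
  have "(\<lambda>i. subst_tm (lift_tms \<sigma>) (lift_tms \<tau> i)) = lift_tms (\<lambda>i. subst_tm \<sigma> (\<tau> i))"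
    by (auto simp: fun_eq_iff lift_shift split: nat.split)
  then show ?case
    by (simp add: AllN)
next
  case (AllS \<phi>)
  have "(\<lambda>X. lift_sets \<rho> (lift_sets \<pi> X)) = lift_sets (\<lambda>X. \<rho> (\<pi> X))"
    by (auto simp: fun_eq_iff split: nat.split)
  then show ?case
    by (simp add: AllS)
qed (simp_all add: subst_tm_subst_tm)

lemma subst_tm_cong:
  "bounded_tm k t \<Longrightarrow> (\<And>i. i < k \<Longrightarrow> \<sigma> i = \<tau> i) \<Longrightarrow> subst_tm \<sigma> t = subst_tm \<tau> t"
  by (induction t) auto

lemma subst_cong:
  assumes "free_below k l \<phi>" "\<And>i. i < k \<Longrightarrow> \<sigma> i = \<tau> i" "\<And>X. X < l \<Longrightarrow> \<rho> X = \<pi> X"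
  shows "subst \<sigma> \<rho> \<phi> = subst \<tau> \<pi> \<phi>"
  using assms
proof (induction \<phi> arbitrary: k l \<sigma> \<rho> \<tau> \<pi>)
  case (AllN \<phi>)
  have "lift_tms \<sigma> i = lift_tms \<tau> i" if "i < Suc k" for i
    using that AllN.prems by (auto split: nat.split)
  then show ?case
    using AllN.IH[of "Suc k" l "lift_tms \<sigma>" "lift_tms \<tau>" \<rho> \<pi>] AllN.prems by simp
next
  case (AllS \<phi>)
  have "lift_sets \<rho> X = lift_sets \<pi> X" if "X < Suc l" for X
    using that AllS.prems by (auto split: nat.split)
  then show ?case
    using AllS.IH[of k "Suc l" \<sigma> \<tau> "lift_sets \<rho>" "lift_sets \<pi>"] AllS.prems by simp
next
  case (Imp \<phi> \<psi>)
  then show ?case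
    by (metis free_below.simps(5) subst.simps(5))
qed (auto intro: subst_tm_cong)

lemma lift_tms_Var: "lift_tms Var = Var"
  by (auto simp: fun_eq_iff shift_tm_def split: nat.split)

lemma lift_sets_id: "lift_sets (\<lambda>X. X) = (\<lambda>X. X)"
  by (auto simp: fun_eq_iff split: nat.split)

lemma subst_Var: "subst Var (\<lambda>X. X) \<phi> = \<phi>"
  by (induction \<phi>) (simp_all add: subst_tm_Var lift_tms_Var lift_sets_id)

lemma subst_closed: "free_below 0 0 \<phi> \<Longrightarrow> subst \<sigma> \<rho> \<phi> = \<phi>"
  by (metis not_less_zero subst_Var subst_cong)

lemma bounded_tm_mono: "bounded_tm k t \<Longrightarrow> k \<le> k' \<Longrightarrow> bounded_tm k' t"
  by (induction t) auto

lemma free_below_mono: "free_below k l \<phi> \<Longrightarrow> k \<le> k' \<Longrightarrow> l \<le> l' \<Longrightarrow> free_below k' l' \<phi>"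
proof (induction \<phi> arbitrary: k l k' l')
  case (Imp \<phi> \<psi>)
  then show ?case
    by simp blast
next
  case (AllN \<phi>)
  then show ?case
    by (metis Suc_le_mono free_below.simps(6))
next
  case (AllS \<phi>)
  then show ?case
    by (metis Suc_le_mono free_below.simps(7))
qed (auto intro: bounded_tm_mono)

lemma bounded_tm_exists: "\<exists>k. bounded_tm k t"
proof (induction t)
  case (Add s t)
  then show ?case
    by (metis bounded_tm.simps(4) bounded_tm_mono linear)
next
  case (Mul s t)
  then show ?case
    by (metis bounded_tm.simps(5) bounded_tm_mono linear)
qed auto

lemma free_below_exists: "\<exists>k. free_below k k \<phi>"
proof (induction \<phi>)
  case (Eq s t)
  then show ?case
    by (metis bounded_tm_exists bounded_tm_mono free_below.simps(1) linear)
next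
  case (Less s t)
  then show ?case
    by (metis bounded_tm_exists bounded_tm_mono free_below.simps(2) linear)
next
  case (Mem t X)
  obtain k where "bounded_tm k t"
    using bounded_tm_exists by blast
  then show ?case
    by (intro exI[of _ "max k (Suc X)"]) (auto intro: bounded_tm_mono)
next
  case (Imp \<phi> \<psi>)
  then obtain k l where "free_below k k \<phi>" "free_below l l \<psi>"
    by blast
  then show ?case
    by (intro exI[of _ "max k l"]) (auto elim: free_below_mono)
next
  case (AllN \<phi>)
  then show ?case
    by (metis free_below.simps(6) free_below_mono le_refl lessI less_imp_le)
next
  case (AllS \<phi>)
  then show ?case
    by (metis free_below.simps(7) free_below_mono le_refl lessI less_imp_le)
qed auto

lemma free_below_finite: "finite G \<Longrightarrow> \<exists>k. \<forall>\<phi>\<in>G. free_below k k \<phi>"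
proof (induction G rule: finite_induct)
  case (insert \<phi> G)
  then obtain k l where "free_below k k \<phi>" "\<forall>\<phi>\<in>G. free_below l l \<phi>"
    using free_below_exists by blast
  then show ?case
    by (intro exI[of _ "max k l"]) (auto intro: free_below_mono[of l l] elim: free_below_mono)
qed auto

lemma closure_closed: "free_below k l \<phi> \<Longrightarrow> free_below 0 0 ((AllN ^^ k) ((AllS ^^ l) \<phi>))"
proof -
  have N: "free_below k l \<psi> \<Longrightarrow> free_below 0 l ((AllN ^^ k) \<psi>)" for l \<psi>
    by (induction k arbitrary: \<psi>) (auto simp: funpow_swap1)
  have S: "free_below k l \<psi> \<Longrightarrow> free_below k 0 ((AllS ^^ l) \<psi>)" for \<psi>
    by (induction l arbitrary: \<psi>) (auto simp: funpow_swap1)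
  assume "free_below k l \<phi>"
  then show ?thesis
    using N S by blast
qed

lemma RCA0_closed: "\<phi> \<in> RCA0 \<Longrightarrow> free_below 0 0 \<phi>"
  by (auto simp: RCA0_def intro: closure_closed)

section \<open>Structural properties of derivations\<close>

lemma weakening: "\<Gamma> \<turnstile> \<phi> \<Longrightarrow> \<Gamma> \<subseteq> \<Delta> \<Longrightarrow> \<Delta> \<turnstile> \<phi>"
proof (induction arbitrary: \<Delta> rule: provable.induct)
  case (EqE \<Gamma> s t \<phi>)
  then show ?case
    by (meson provable.EqE)
next
  case (ImpI \<phi> \<Gamma> \<psi>)
  then show ?case
    by (meson insert_mono provable.ImpI)
next
  case (Contr \<phi> \<Gamma>)
  then show ?case
    by (meson insert_mono provable.Contr)
next
  case (AllNI \<Gamma> \<phi>)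
  then show ?case
    by (meson image_mono provable.AllNI)
next
  case (AllSI \<Gamma> \<phi>)
  then show ?case
    by (meson image_mono provable.AllSI)
qed (auto intro: provable.intros)

lemma subst_instN: "subst \<sigma> \<rho> (instN t \<phi>) = instN (subst_tm \<sigma> t) (subst (lift_tms \<sigma>) \<rho> \<phi>)"
proof -
  have "(\<lambda>i. subst_tm \<sigma> (case_nat t Var i))
      = (\<lambda>i. subst_tm (case_nat (subst_tm \<sigma> t) Var) (lift_tms \<sigma> i))"
    by (auto simp: fun_eq_iff shift_tm_1 subst_tm_subst_tm subst_tm_Var split: nat.split)
  then show ?thesis
    by (simp add: instN_def subst_subst)
qed

lemma subst_instS: "subst \<sigma> \<rho> (instS X \<phi>) = instS (\<rho> X) (subst \<sigma> (lift_sets \<rho>) \<phi>)"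
proof -
  have "(\<lambda>Y. \<rho> (case_nat X id Y)) = (\<lambda>Y. case_nat (\<rho> X) id (lift_sets \<rho> Y))"
    by (auto simp: fun_eq_iff split: nat.split)
  then show ?thesis
    by (simp add: instS_def subst_subst subst_tm_Var)
qed

lemma subst_shiftN: "subst (lift_tms \<sigma>) \<rho> (shiftN \<phi>) = shiftN (subst \<sigma> \<rho> \<phi>)"
  by (simp add: shiftN_def subst_subst shift_tm_1)

lemma subst_shiftS: "subst \<sigma> (lift_sets \<rho>) (shiftS \<phi>) = shiftS (subst \<sigma> \<rho> \<phi>)"
  by (simp add: shiftS_def subst_subst subst_tm_Var)

lemma provable_subst: "\<Gamma> \<turnstile> \<phi> \<Longrightarrow> subst \<sigma> \<rho> ` \<Gamma> \<turnstile> subst \<sigma> \<rho> \<phi>"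
proof (induction arbitrary: \<sigma> \<rho> rule: provable.induct)
  case (Contr \<phi> \<Gamma>)
  then show ?case
    by (auto intro: provable.Contr)
next
  case (ImpE \<Gamma> \<phi> \<psi>)
  then show ?case
    by (metis provable.ImpE subst.simps(5))
next
  case (AllNI \<Gamma> \<phi>)
  have "subst (lift_tms \<sigma>) \<rho> ` shiftN ` \<Gamma> = shiftN ` subst \<sigma> \<rho> ` \<Gamma>"
    by (simp only: image_image subst_shiftN)
  then show ?case
    using AllNI.IH[of "lift_tms \<sigma>" \<rho>] by (simp add: provable.AllNI)
next
  case (AllNE \<Gamma> \<phi> t)
  then show ?case
    using provable.AllNE by (simp add: subst_instN)
next
  case (AllSI \<Gamma> \<phi>)
  have "subst \<sigma> (lift_sets \<rho>) ` shiftS ` \<Gamma> = shiftS ` subst \<sigma> \<rho> ` \<Gamma>"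
    by (simp only: image_image subst_shiftS)
  then show ?case
    using AllSI.IH[of \<sigma> "lift_sets \<rho>"] by (simp add: provable.AllSI)
next
  case (AllSE \<Gamma> \<phi> X)
  then show ?case
    using provable.AllSE by (simp add: subst_instS)
next
  case (EqE \<Gamma> s t \<phi>)
  then show ?case
    using provable.EqE[of _ "subst_tm \<sigma> s" "subst_tm \<sigma> t"] by (simp add: subst_instN)
qed (auto intro: provable.intros)

lemma provable_finite: "\<Gamma> \<turnstile> \<phi> \<Longrightarrow> \<exists>\<Gamma>0. finite \<Gamma>0 \<and> \<Gamma>0 \<subseteq> \<Gamma> \<and> \<Gamma>0 \<turnstile> \<phi>"
proof (induction rule: provable.induct)
  case (Assm \<phi> \<Gamma>)
  then show ?case
    by (intro exI[of _ "{\<phi>}"]) (auto intro: provable.Assm)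
next
  case (ImpI \<phi> \<Gamma> \<psi>)
  then obtain G where G: "finite G" "G \<subseteq> insert \<phi> \<Gamma>" "G \<turnstile> \<psi>"
    by blast
  then have "G - {\<phi>} \<turnstile> Imp \<phi> \<psi>"
    by (auto intro: provable.ImpI weakening)
  then show ?case
    using G by (intro exI[of _ "G - {\<phi>}"]) auto
next
  case (Contr \<phi> \<Gamma>)
  then obtain G where G: "finite G" "G \<subseteq> insert (Neg \<phi>) \<Gamma>" "G \<turnstile> Bot"
    by blast
  then have "G - {Neg \<phi>} \<turnstile> \<phi>"
    by (auto intro: provable.Contr weakening)
  then show ?case
    using G by (intro exI[of _ "G - {Neg \<phi>}"]) auto
next
  case (ImpE \<Gamma> \<phi> \<psi>)
  then obtain G H where "finite G" "G \<subseteq> \<Gamma>" "G \<turnstile> Imp \<phi> \<psi>" "finite H" "H \<subseteq> \<Gamma>" "H \<turnstile> \<phi>"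
    by blast
  then show ?case
    by (intro exI[of _ "G \<union> H"]) (auto intro: provable.ImpE[of _ \<phi>] weakening)
next
  case (AllNI \<Gamma> \<phi>)
  then show ?case
    by (metis finite_subset_image provable.AllNI)
next
  case (AllNE \<Gamma> \<phi> t)
  then show ?case
    by (meson provable.AllNE)
next
  case (AllSI \<Gamma> \<phi>)
  then show ?case
    by (metis finite_subset_image provable.AllSI)
next
  case (AllSE \<Gamma> \<phi> X)
  then show ?case
    by (meson provable.AllSE)
next
  case (EqI \<Gamma> t)
  then show ?case
    by (meson empty_subsetI finite.emptyI provable.EqI)
next
  case (EqE \<Gamma> s t \<phi>)
  then obtain G H where "finite G" "G \<subseteq> \<Gamma>" "G \<turnstile> Eq s t" "finite H" "H \<subseteq> \<Gamma>" "H \<turnstile> instN s \<phi>"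
    by blast
  then show ?case
    by (intro exI[of _ "G \<union> H"]) (auto intro: provable.EqE[of _ s] weakening)
qed

section \<open>Henkin extensions\<close>

definition consistent :: "fm set \<Rightarrow> bool" where
  "consistent \<Gamma> \<longleftrightarrow> \<not> \<Gamma> \<turnstile> Bot"

instance tm :: countable
  by countable_datatype

instance fm :: countable
  by countable_datatype

lemma cut: "\<Gamma> \<turnstile> \<phi> \<Longrightarrow> insert \<phi> \<Gamma> \<turnstile> \<psi> \<Longrightarrow> \<Gamma> \<turnstile> \<psi>"
  by (meson ImpE ImpI)

text \<open>
  A number variable that occurs neither in the hypotheses nor in \<open>\<psi>\<close> is as good as an
  eigenvariable: renaming it to index 0 and all other variables \<open>i\<close> to \<open>i + 1\<close> turns a derivation of
  the instance into a premise of the introduction rule.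
\<close>

lemma generalize_variable:
  assumes "\<Gamma> \<turnstile> instN (Var k) \<psi>" and fresh: "\<And>\<chi>. \<chi> \<in> insert (AllN \<psi>) \<Gamma> \<Longrightarrow> free_below k l \<chi>"
  shows "\<Gamma> \<turnstile> AllN \<psi>"
proof -
  define \<sigma> where "\<sigma> i = (if i = k then Var 0 else Var (Suc i))" for i
  have "subst \<sigma> id \<chi> = shiftN \<chi>" if "\<chi> \<in> \<Gamma>" for \<chi>
    unfolding shiftN_def by (rule subst_cong[of k l]) (use that fresh in \<open>auto simp: \<sigma>_def\<close>)
  then have *: "subst \<sigma> id ` \<Gamma> = shiftN ` \<Gamma>"
    by simp
  have "subst \<sigma> id (instN (Var k) \<psi>) = subst (\<lambda>i. subst_tm \<sigma> (case_nat (Var k) Var i)) id \<psi>"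
    by (simp add: instN_def subst_subst id_def)
  also have "\<dots> = subst Var (\<lambda>X. X) \<psi>"
  proof (rule subst_cong[of "Suc k" l])
    show "free_below (Suc k) l \<psi>"
      using fresh[of "AllN \<psi>"] by simp
  qed (auto simp: \<sigma>_def split: nat.split)
  finally have "subst \<sigma> id (instN (Var k) \<psi>) = \<psi>"
    by (simp add: subst_Var)
  then show ?thesis
    using provable_subst[OF assms(1), of \<sigma> id] * by (simp add: AllNI)
qed

lemma generalize_set_variable:
  assumes "\<Gamma> \<turnstile> instS l \<psi>" and fresh: "\<And>\<chi>. \<chi> \<in> insert (AllS \<psi>) \<Gamma> \<Longrightarrow> free_below k l \<chi>"
  shows "\<Gamma> \<turnstile> AllS \<psi>"
proof -
  define \<rho> where "\<rho> X = (if X = l then 0 else Suc X)" for X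
  have "subst Var \<rho> \<chi> = shiftS \<chi>" if "\<chi> \<in> \<Gamma>" for \<chi>
    unfolding shiftS_def by (rule subst_cong[of k l]) (use that fresh in \<open>auto simp: \<rho>_def\<close>)
  then have *: "subst Var \<rho> ` \<Gamma> = shiftS ` \<Gamma>"
    by simp
  have "subst Var \<rho> (instS l \<psi>) = subst Var (\<lambda>X. \<rho> (case_nat l id X)) \<psi>"
    by (simp add: instS_def subst_subst)
  also have "\<dots> = subst Var (\<lambda>X. X) \<psi>"
  proof (rule subst_cong[of k "Suc l"])
    show "free_below k (Suc l) \<psi>"
      using fresh[of "AllS \<psi>"] by simp
  qed (auto simp: \<rho>_def split: nat.split)
  finally have "subst Var \<rho> (instS l \<psi>) = \<psi>"
    by (simp add: subst_Var)
  then show ?thesis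
    using provable_subst[OF assms(1), of Var \<rho>] * by (simp add: AllSI)
qed

text \<open>
  The last two clauses provide witnesses: a universal formula is refuted only together with one of
  its instances.
\<close>

definition decides :: "fm set \<Rightarrow> fm \<Rightarrow> bool" where
  "decides G \<phi> \<longleftrightarrow> \<phi> \<in> G \<or> Neg \<phi> \<in> G
     \<and> (\<forall>\<psi>. \<phi> = AllN \<psi> \<longrightarrow> (\<exists>t. Neg (instN t \<psi>) \<in> G))
     \<and> (\<forall>\<psi>. \<phi> = AllS \<psi> \<longrightarrow> (\<exists>X. Neg (instS X \<psi>) \<in> G))"

text \<open>
  If \<open>\<phi>\<close> is not derivable, its negation can be added. If \<open>\<phi>\<close> is moreover universal, so can the
  negation of its instance at a variable that is fresh for the finite set \<open>G\<close>: the formulas in \<open>\<Gamma>\<close> are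
  sentences, so that a derivation of the instance would generalize to a derivation of \<open>\<phi>\<close>.
\<close>

lemma decide_formula:
  assumes "\<And>\<chi>. \<chi> \<in> \<Gamma> \<Longrightarrow> free_below 0 0 \<chi>" "finite G" and con: "consistent (\<Gamma> \<union> G)"
  shows "\<exists>G'. finite G' \<and> G \<subseteq> G' \<and> consistent (\<Gamma> \<union> G') \<and> decides G' \<phi>"
proof (cases "\<Gamma> \<union> G \<turnstile> \<phi>")
  case True
  then have "consistent (\<Gamma> \<union> insert \<phi> G)"
    using con cut unfolding consistent_def by (metis Un_insert_right)
  then show ?thesis
    using \<open>finite G\<close> by (intro exI[of _ "insert \<phi> G"]) (auto simp: decides_def)
next
  case False
  define D where "D = insert (Neg \<phi>) (\<Gamma> \<union> G)"
  have D: "consistent D"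
    using False Contr unfolding D_def consistent_def by blast
  obtain k where k: "\<forall>\<chi>\<in>insert \<phi> G. free_below k k \<chi>"
    using free_below_finite \<open>finite G\<close> by (meson finite_insert)
  have fresh: "free_below k k \<chi>" if "\<chi> \<in> insert \<phi> D" for \<chi>
    using that k assms(1) by (auto simp: D_def intro: free_below_mono)
  have "\<not> D \<turnstile> \<phi>"
    using D Assm[of "Neg \<phi>" D] ImpE[of D \<phi> Bot] unfolding consistent_def D_def by blast
  then have wN: "consistent (insert (Neg (instN (Var k) \<psi>)) D)" if "\<phi> = AllN \<psi>" for \<psi>
    using that generalize_variable[of D k \<psi> k] fresh Contr unfolding consistent_def by metis
  have wS: "consistent (insert (Neg (instS k \<psi>)) D)" if "\<phi> = AllS \<psi>" for \<psi>
    using \<open>\<not> D \<turnstile> \<phi>\<close> that generalize_set_variable[of D k \<psi> k] fresh Contr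
    unfolding consistent_def by metis
  consider (N) \<psi> where "\<phi> = AllN \<psi>" | (S) \<psi> where "\<phi> = AllS \<psi>"
    | (other) "\<forall>\<psi>. \<phi> \<noteq> AllN \<psi> \<and> \<phi> \<noteq> AllS \<psi>"
    by blast
  then show ?thesis
  proof cases
    case N
    show ?thesis
    proof (intro exI conjI)
      show "consistent (\<Gamma> \<union> ({Neg (instN (Var k) \<psi>), Neg \<phi>} \<union> G))"
        using wN[OF N] by (simp add: D_def)
      show "decides ({Neg (instN (Var k) \<psi>), Neg \<phi>} \<union> G) \<phi>"
        using N unfolding decides_def by blast
    qed (use \<open>finite G\<close> in auto)
  next
    case S
    show ?thesis
    proof (intro exI conjI)
      show "consistent (\<Gamma> \<union> ({Neg (instS k \<psi>), Neg \<phi>} \<union> G))"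
        using wS[OF S] by (simp add: D_def)
      show "decides ({Neg (instS k \<psi>), Neg \<phi>} \<union> G) \<phi>"
        using S unfolding decides_def by blast
    qed (use \<open>finite G\<close> in auto)
  next
    case other
    show ?thesis
    proof (intro exI conjI)
      show "consistent (\<Gamma> \<union> insert (Neg \<phi>) G)"
        using D by (simp add: D_def)
      show "decides (insert (Neg \<phi>) G) \<phi>"
        using other unfolding decides_def by blast
    qed (use \<open>finite G\<close> in auto)
  qed
qed

lemma decides_mono: "decides G \<phi> \<Longrightarrow> G \<subseteq> H \<Longrightarrow> decides H \<phi>"
  unfolding decides_def by blast

locale Henkin =
  fixes T :: "fm set"
  assumes consistent: "consistent T" and decided: "decides T \<phi>"

text \<open>
  All formulas are decided one after the other. Each stage adds finitely many formulas to \<open>\<Gamma>\<close>, which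
  leaves fresh variables for the next one, and the union is consistent because derivations are finite.
\<close>

lemma Henkin_extension:
  assumes closed: "\<And>\<chi>. \<chi> \<in> \<Gamma> \<Longrightarrow> free_below 0 0 \<chi>" and con: "consistent \<Gamma>"
  shows "\<exists>T. \<Gamma> \<subseteq> T \<and> Henkin T"
proof -
  have "\<exists>g. \<forall>n. (finite (g n) \<and> consistent (\<Gamma> \<union> g n)) \<and>
          (g n \<subseteq> g (Suc n) \<and> decides (g (Suc n)) (from_nat n))"
  proof (rule dependent_nat_choice)
    show "\<exists>G. finite G \<and> consistent (\<Gamma> \<union> G)"
      using con by (intro exI[of _ "{}"]) simp
  next
    fix G n
    assume "finite G \<and> consistent (\<Gamma> \<union> G)"
    then show "\<exists>G'. (finite G' \<and> consistent (\<Gamma> \<union> G')) \<and> G \<subseteq> G' \<and> decides G' (from_nat n)"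
      using decide_formula closed by meson
  qed
  then obtain g where g: "\<And>n. consistent (\<Gamma> \<union> g n)" "\<And>n. g n \<subseteq> g (Suc n)"
      "\<And>n. decides (g (Suc n)) (from_nat n)"
    by blast
  have mono: "m \<le> n \<Longrightarrow> g m \<subseteq> g n" for m n
    using g(2) by (rule lift_Suc_mono_le)
  define T where "T = \<Gamma> \<union> (\<Union>n. g n)"
  have "consistent T"
    unfolding consistent_def
  proof
    assume "T \<turnstile> Bot"
    then obtain F where F: "finite F" "F \<subseteq> T" "F \<turnstile> Bot"
      using provable_finite by blast
    have "\<exists>n. F \<subseteq> \<Gamma> \<union> g n"
      using F(1,2)
    proof (induction F rule: finite_induct)
      case (insert \<chi> F)
      then obtain n m where "F \<subseteq> \<Gamma> \<union> g n" "\<chi> \<in> \<Gamma> \<union> g m"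
        by (auto simp: T_def)
      then show ?case
        using mono[of n "max n m"] mono[of m "max n m"] by (intro exI[of _ "max n m"]) auto
    qed simp
    then show False
      using F(3) weakening g(1) unfolding consistent_def by blast
  qed
  moreover have "decides T \<phi>" for \<phi>
    by (rule decides_mono[of "g (Suc (to_nat \<phi>))"]) (use g(3)[of "to_nat \<phi>"] in \<open>auto simp: T_def\<close>)
  ultimately have "Henkin T"
    by (simp add: Henkin_def)
  then show ?thesis
    by (intro exI[of _ T]) (auto simp: T_def)
qed

context Henkin
begin

lemma neg_iff: "Neg \<phi> \<in> T \<longleftrightarrow> \<phi> \<notin> T"
proof
  show "Neg \<phi> \<in> T \<Longrightarrow> \<phi> \<notin> T"
    using consistent Assm ImpE unfolding consistent_def by blast
  show "\<phi> \<notin> T \<Longrightarrow> Neg \<phi> \<in> T"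
    using decided[of \<phi>] by (auto simp: decides_def)
qed

lemma provable_mem: "T \<turnstile> \<phi> \<Longrightarrow> \<phi> \<in> T"
  using neg_iff consistent Assm ImpE unfolding consistent_def by blast

lemma bot_notin: "Bot \<notin> T"
  using consistent Assm unfolding consistent_def by blast

lemma imp_iff: "Imp \<phi> \<psi> \<in> T \<longleftrightarrow> (\<phi> \<in> T \<longrightarrow> \<psi> \<in> T)"
proof
  show "Imp \<phi> \<psi> \<in> T \<Longrightarrow> \<phi> \<in> T \<longrightarrow> \<psi> \<in> T"
    by (meson Assm ImpE provable_mem)
  assume a: "\<phi> \<in> T \<longrightarrow> \<psi> \<in> T"
  show "Imp \<phi> \<psi> \<in> T"
  proof (cases "\<phi> \<in> T")
    case True
    then show ?thesis
      using a by (auto intro!: provable_mem ImpI intro: Assm)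
  next
    case False
    then have "Neg \<phi> \<in> T"
      by (simp add: neg_iff)
    then have "insert \<phi> T \<turnstile> Bot"
      by (meson Assm ImpE insertCI)
    then have "insert \<phi> T \<turnstile> \<psi>"
      by (auto intro: Contr weakening)
    then show ?thesis
      by (intro provable_mem ImpI)
  qed
qed

lemma allN_iff: "AllN \<phi> \<in> T \<longleftrightarrow> (\<forall>t. instN t \<phi> \<in> T)"
proof
  show "AllN \<phi> \<in> T \<Longrightarrow> \<forall>t. instN t \<phi> \<in> T"
    by (meson AllNE Assm provable_mem)
  show "\<forall>t. instN t \<phi> \<in> T \<Longrightarrow> AllN \<phi> \<in> T"
    using decided[of "AllN \<phi>"] neg_iff by (auto simp: decides_def)
qed

lemma allS_iff: "AllS \<phi> \<in> T \<longleftrightarrow> (\<forall>X. instS X \<phi> \<in> T)"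
proof
  show "AllS \<phi> \<in> T \<Longrightarrow> \<forall>X. instS X \<phi> \<in> T"
    by (meson AllSE Assm provable_mem)
  show "\<forall>X. instS X \<phi> \<in> T \<Longrightarrow> AllS \<phi> \<in> T"
    using decided[of "AllS \<phi>"] neg_iff by (auto simp: decides_def)
qed

lemma eq_refl: "Eq t t \<in> T"
  by (simp add: EqI provable_mem)

lemma eq_replace: "Eq s t \<in> T \<Longrightarrow> instN s \<phi> \<in> T \<Longrightarrow> instN t \<phi> \<in> T"
  by (meson Assm EqE provable_mem)

lemma instN_shift: "subst_tm (case_nat t Var) (shift_tm 1 s) = s"
  by (simp add: shift_tm_1 subst_tm_subst_tm subst_tm_Var)

lemma eq_sym: "Eq s t \<in> T \<Longrightarrow> Eq t s \<in> T"
  using eq_replace[of s t "Eq (Var 0) (shift_tm 1 s)"] eq_refl[of s]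
  by (simp add: instN_def instN_shift)

lemma eq_trans: "Eq s t \<in> T \<Longrightarrow> Eq t u \<in> T \<Longrightarrow> Eq s u \<in> T"
  using eq_replace[of t u "Eq (shift_tm 1 s) (Var 0)"] by (simp add: instN_def instN_shift)

lemma eq_Add: 
  assumes "Eq s s' \<in> T" "Eq t t' \<in> T"
  shows "Eq (Add s t) (Add s' t') \<in> T"
proof -
  have "Eq (Add s t) (Add s' t) \<in> T"
    using eq_replace[OF assms(1), of "Eq (shift_tm 1 (Add s t)) (Add (Var 0) (shift_tm 1 t))"] eq_refl[of "Add s t"]
    by (simp add: instN_def instN_shift)
  then show ?thesis
    using eq_replace[OF assms(2), of "Eq (shift_tm 1 (Add s t)) (Add (shift_tm 1 s') (Var 0))"]
    by (simp add: instN_def instN_shift)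
qed

lemma eq_Mul: 
  assumes "Eq s s' \<in> T" "Eq t t' \<in> T"
  shows "Eq (Mul s t) (Mul s' t') \<in> T"
proof -
  have "Eq (Mul s t) (Mul s' t) \<in> T"
    using eq_replace[OF assms(1), of "Eq (shift_tm 1 (Mul s t)) (Mul (Var 0) (shift_tm 1 t))"] eq_refl[of "Mul s t"]
    by (simp add: instN_def instN_shift)
  then show ?thesis
    using eq_replace[OF assms(2), of "Eq (shift_tm 1 (Mul s t)) (Mul (shift_tm 1 s') (Var 0))"]
    by (simp add: instN_def instN_shift)
qed

lemma less_cong: 
  assumes "Eq s s' \<in> T" "Eq t t' \<in> T" "Less s t \<in> T"
  shows "Less s' t' \<in> T"
proof -
  have "Less s' t \<in> T"
    using eq_replace[OF assms(1), of "Less (Var 0) (shift_tm 1 t)"] assms(3)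
    by (simp add: instN_def instN_shift)
  then show ?thesis
    using eq_replace[OF assms(2), of "Less (shift_tm 1 s') (Var 0)"]
    by (simp add: instN_def instN_shift)
qed

lemma mem_cong: "Eq s t \<in> T \<Longrightarrow> Mem s X \<in> T \<Longrightarrow> Mem t X \<in> T"
  using eq_replace[of s t "Mem (Var 0) X"] by (simp add: instN_def)

text \<open>
  The universal quantifiers can be stripped one at a time once arbitrary substitutions are admitted: a
  substitution in the matrix is an instance of a substitution in the quantified formula.
\<close>

lemma closure_instance:
  assumes "(AllN ^^ k) ((AllS ^^ l) \<phi>) \<in> T" "free_below k l \<phi>"
  shows "subst \<sigma> \<rho> \<phi> \<in> T"
proof -
  define valid where "valid \<psi> \<longleftrightarrow> (\<forall>\<sigma> \<rho>. subst \<sigma> \<rho> \<psi> \<in> T)" for \<psi>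
  have N: "valid \<psi>" if "valid (AllN \<psi>)" for \<psi>
    unfolding valid_def
  proof (intro allI)
    fix \<sigma> \<rho>
    have *: "subst_tm (case_nat (\<sigma> 0) Var) (lift_tms (\<lambda>i. \<sigma> (Suc i)) i) = \<sigma> i" for i
      by (cases i) (auto simp: instN_shift)
    have "instN (\<sigma> 0) (subst (lift_tms (\<lambda>i. \<sigma> (Suc i))) \<rho> \<psi>) \<in> T"
      using that unfolding valid_def by (auto simp: allN_iff)
    then show "subst \<sigma> \<rho> \<psi> \<in> T"
      using * by (simp add: instN_def subst_subst)
  qed
  have S: "valid \<psi>" if "valid (AllS \<psi>)" for \<psi>
    unfolding valid_def
  proof (intro allI)
    fix \<sigma> \<rho>
    have *: "case_nat (\<rho> 0) id (lift_sets (\<lambda>i. \<rho> (Suc i)) i) = \<rho> i" for i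
      by (cases i) auto
    have "instS (\<rho> 0) (subst \<sigma> (lift_sets (\<lambda>i. \<rho> (Suc i))) \<psi>) \<in> T"
      using that unfolding valid_def by (auto simp: allS_iff)
    then show "subst \<sigma> \<rho> \<psi> \<in> T"
      using * by (simp add: instS_def subst_subst subst_tm_Var)
  qed
  have "valid ((AllN ^^ k) ((AllS ^^ l) \<phi>))"
    using assms subst_closed[OF closure_closed] by (simp add: valid_def)
  then have "valid ((AllS ^^ l) \<phi>)"
    by (induction k) (auto dest: N)
  then have "valid \<phi>"
    by (induction l) (auto dest: S)
  then show ?thesis
    by (simp add: valid_def)
qed

end

section \<open>Structures for the language and the completeness theorem\<close>

text \<open>
  Henkin semantics: the set quantifiers range over the family \<open>S\<close> instead of all sets.
\<close>

locale arith_structure =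
  fixes zero :: 'a ("\<zero>") and one :: 'a ("\<one>")
    and plus :: "'a \<Rightarrow> 'a \<Rightarrow> 'a" (infixl "\<oplus>" 65)
    and times :: "'a \<Rightarrow> 'a \<Rightarrow> 'a" (infixl "\<otimes>" 70)
    and less :: "'a \<Rightarrow> 'a \<Rightarrow> bool" (infix "\<prec>" 50)
    and S :: "'a set set"
begin

primrec eval :: "(nat \<Rightarrow> 'a) \<Rightarrow> tm \<Rightarrow> 'a" where
  "eval e (Var i) = e i"
| "eval e Zero = \<zero>"
| "eval e One = \<one>"
| "eval e (Add s t) = eval e s \<oplus> eval e t"
| "eval e (Mul s t) = eval e s \<otimes> eval e t"

primrec sat :: "(nat \<Rightarrow> 'a) \<Rightarrow> (nat \<Rightarrow> 'a set) \<Rightarrow> fm \<Rightarrow> bool" where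
  "sat e E (Eq s t) \<longleftrightarrow> eval e s = eval e t"
| "sat e E (Less s t) \<longleftrightarrow> eval e s \<prec> eval e t"
| "sat e E (Mem t X) \<longleftrightarrow> eval e t \<in> E X"
| "sat e E Bot \<longleftrightarrow> False"
| "sat e E (Imp \<phi> \<psi>) \<longleftrightarrow> (sat e E \<phi> \<longrightarrow> sat e E \<psi>)"
| "sat e E (AllN \<phi>) \<longleftrightarrow> (\<forall>x. sat (case_nat x e) E \<phi>)"
| "sat e E (AllS \<phi>) \<longleftrightarrow> (\<forall>X\<in>S. sat e (case_nat X E) \<phi>)"

lemma eval_subst: "eval e (subst_tm \<sigma> t) = eval (\<lambda>i. eval e (\<sigma> i)) t"
  by (induction t) auto

lemma eval_shift: "eval e (shift_tm k t) = eval (\<lambda>i. e (i + k)) t"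
  by (simp add: shift_tm_def eval_subst)

lemma sat_subst: "sat e E (subst \<sigma> \<rho> \<phi>) \<longleftrightarrow> sat (\<lambda>i. eval e (\<sigma> i)) (\<lambda>X. E (\<rho> X)) \<phi>"
proof (induction \<phi> arbitrary: e E \<sigma> \<rho>)
  case (AllN \<phi>)
  have "(\<lambda>i. eval (case_nat x e) (lift_tms \<sigma> i)) = case_nat x (\<lambda>i. eval e (\<sigma> i))" for x
    by (auto simp: fun_eq_iff shift_tm_1 eval_subst split: nat.split)
  then show ?case
    by (simp add: AllN)
next
  case (AllS \<phi>)
  have "(\<lambda>Y. case_nat X E (lift_sets \<rho> Y)) = case_nat X (\<lambda>Y. E (\<rho> Y))" for X
    by (auto simp: fun_eq_iff split: nat.split)
  then show ?case
    by (simp add: AllS)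
qed (simp_all add: eval_subst)

end

locale RCA0_model = arith_structure +
  assumes sets_nonempty: "S \<noteq> {}"
    and axiom_true: "\<phi> \<in> RCA0_axioms \<Longrightarrow> range E \<subseteq> S \<Longrightarrow> sat e E \<phi>"

primrec numeral_tm :: "nat \<Rightarrow> tm" where
  "numeral_tm 0 = Zero"
| "numeral_tm (Suc n) = Add (numeral_tm n) One"

context Henkin
begin

text \<open>
  The terms modulo provable equality are infinitely many, because the successor function is injective
  and omits zero. Being countable, the quotient can be enumerated by the natural numbers; so the
  term model has the full type of natural numbers as its domain.
\<close>

lemma term_quotient:
  assumes succ: "\<And>s. Eq (Add s One) Zero \<notin> T"
    "\<And>s t. Eq (Add s One) (Add t One) \<in> T \<Longrightarrow> Eq s t \<in> T"
  shows "\<exists>v :: tm \<Rightarrow> nat. surj v \<and> (\<forall>s t. v s = v t \<longleftrightarrow> Eq s t \<in> T)"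
proof -
  define cls where "cls t = {s. Eq s t \<in> T}" for t
  have cls: "cls s = cls t \<longleftrightarrow> Eq s t \<in> T" for s t
    using eq_refl eq_sym eq_trans unfolding cls_def by blast
  have "Eq (numeral_tm m) (numeral_tm n) \<in> T \<Longrightarrow> m = n" for m n
  proof (induction m arbitrary: n)
    case 0
    then show ?case
      using succ(1) eq_sym by (cases n) auto
  next
    case (Suc m)
    then show ?case
      using succ by (cases n) auto
  qed
  then have "inj (\<lambda>n. cls (numeral_tm n))"
    by (auto intro: injI simp: cls)
  then have "infinite (range (\<lambda>n. cls (numeral_tm n)))"
    by (rule range_inj_infinite)
  then have inf: "infinite (range cls)"
    by (rule contrapos_nn) (auto elim: finite_subset[rotated])
  have count: "countable (range cls)"
    by simp
  define v where "v t = to_nat_on (range cls) (cls t)" for t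
  have "\<exists>t. y = v t" for y
    using to_nat_on_surj[OF count inf, of y] by (auto simp: v_def)
  then have "surj v"
    by (simp add: surj_def)
  moreover have "v s = v t \<longleftrightarrow> Eq s t \<in> T" for s t
    unfolding v_def cls[symmetric] by (rule to_nat_on_inj[OF count]) auto
  ultimately show ?thesis
    by blast
qed

end

lemma RCA0_basic_axiom: "\<phi> \<in> basic_axioms \<Longrightarrow> (AllN ^^ 2) \<phi> \<in> RCA0"
  unfolding RCA0_def RCA0_axioms_def
  by (rule CollectI, intro exI[of _ 2] exI[of _ 0] exI[of _ \<phi>]) (auto simp: basic_axioms_def Let_def)

text \<open>
  Completeness of the calculus for \<^const>\<open>RCA0\<close>. In the term model of a Henkin extension the numbers are
  the terms modulo provable equality, and the sets are the extensions of the set variables; different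
  variables may have the same extension, which does no harm since the language has no equality of sets.
  The truth lemma is stated for all substitution instances, so that the induction on formulas passes
  through the quantifiers.
\<close>

theorem countermodel:
  assumes unprovable: "\<not> RCA0 \<turnstile> \<phi>" and closed: "free_below 0 0 \<phi>"
  shows "\<exists>zero one plus times less (S :: nat set set). RCA0_model zero one plus times less S
    \<and> (\<exists>e E. range E \<subseteq> S \<and> \<not> arith_structure.sat zero one plus times less S e E \<phi>)"
proof -
  have "consistent (insert (Neg \<phi>) RCA0)"
    using unprovable Contr unfolding consistent_def by blast
  moreover have "free_below 0 0 \<chi>" if "\<chi> \<in> insert (Neg \<phi>) RCA0" for \<chi>
    using that closed RCA0_closed by auto
  ultimately obtain T where T: "insert (Neg \<phi>) RCA0 \<subseteq> T" and "Henkin T"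
    using Henkin_extension by blast
  interpret Henkin T by fact
  have basic: "subst \<sigma> \<rho> \<chi> \<in> T" if "\<chi> \<in> basic_axioms" for \<chi> \<sigma> \<rho>
    using closure_instance[of 2 0 \<chi> \<sigma> \<rho>] RCA0_basic_axiom[OF that] T that
    by (auto simp: basic_axioms_def Let_def)
  have "Eq (Add s One) Zero \<notin> T" for s
    using basic[of "Neg (Eq (Add (Var 1) One) Zero)" "\<lambda>_. s"]
    by (simp add: basic_axioms_def Let_def neg_iff)
  moreover have "Eq (Add s One) (Add t One) \<in> T \<Longrightarrow> Eq s t \<in> T" for s t
    using basic[of "Imp (Eq (Add (Var 0) One) (Add (Var 1) One)) (Eq (Var 0) (Var 1))" "case_nat s (\<lambda>_. t)"]
    by (simp add: basic_axioms_def Let_def imp_iff One_nat_def)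
  ultimately obtain v :: "tm \<Rightarrow> nat" where "surj v" and v: "\<And>s t. v s = v t \<longleftrightarrow> Eq s t \<in> T"
    using term_quotient by blast
  define w where "w = inv v"
  have vw: "v (w a) = a" for a
    using \<open>surj v\<close> by (simp add: w_def surj_f_inv_f)
  have wv: "Eq (w (v t)) t \<in> T" for t
    using v vw by blast
  define ext where "ext X = {a. Mem (w a) X \<in> T}" for X
  have v_ext: "v t \<in> ext X \<longleftrightarrow> Mem t X \<in> T" for t X
    unfolding ext_def using mem_cong wv eq_sym by blast
  define plus where "plus a b = v (Add (w a) (w b))" for a b
  define times where "times a b = v (Mul (w a) (w b))" for a b
  define less where "less a b \<longleftrightarrow> Less (w a) (w b) \<in> T" for a b
  have v_plus: "plus (v s) (v t) = v (Add s t)" for s t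
    unfolding plus_def by (simp add: v eq_Add wv)
  have v_times: "times (v s) (v t) = v (Mul s t)" for s t
    unfolding times_def by (simp add: v eq_Mul wv)
  have v_less: "less (v s) (v t) \<longleftrightarrow> Less s t \<in> T" for s t
    unfolding less_def using less_cong wv eq_sym by blast
  interpret M: arith_structure "v Zero" "v One" plus times less "range ext" .
  have eval: "M.eval (\<lambda>i. v (\<sigma> i)) t = v (subst_tm \<sigma> t)" for \<sigma> t
    by (induction t) (simp_all add: v_plus v_times)
  have truth: "M.sat (\<lambda>i. v (\<sigma> i)) (\<lambda>X. ext (\<rho> X)) \<chi> \<longleftrightarrow> subst \<sigma> \<rho> \<chi> \<in> T" for \<sigma> \<rho> \<chi>
  proof (induction \<chi> arbitrary: \<sigma> \<rho>)
    case (AllN \<chi>)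
    have inst: "instN t (subst (lift_tms \<sigma>) \<rho> \<chi>) = subst (case_nat t \<sigma>) \<rho> \<chi>" for t
    proof -
      have "(\<lambda>i. subst_tm (case_nat t Var) (lift_tms \<sigma> i)) = case_nat t \<sigma>"
        by (auto simp: fun_eq_iff instN_shift split: nat.split)
      then show ?thesis
        by (simp add: instN_def subst_subst)
    qed
    have env: "case_nat (v t) (\<lambda>i. v (\<sigma> i)) = (\<lambda>i. v (case_nat t \<sigma> i))" for t
      by (auto simp: fun_eq_iff split: nat.split)
    have "M.sat (\<lambda>i. v (\<sigma> i)) (\<lambda>X. ext (\<rho> X)) (AllN \<chi>)
        \<longleftrightarrow> (\<forall>t. M.sat (case_nat (v t) (\<lambda>i. v (\<sigma> i))) (\<lambda>X. ext (\<rho> X)) \<chi>)"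
      by (metis M.sat.simps(6) vw)
    then show ?case
      by (simp add: env AllN.IH allN_iff inst)
  next
    case (AllS \<chi>)
    have inst: "instS X (subst \<sigma> (lift_sets \<rho>) \<chi>) = subst \<sigma> (case_nat X \<rho>) \<chi>" for X
    proof -
      have "(\<lambda>i. case_nat X id (lift_sets \<rho> i)) = case_nat X \<rho>"
        by (auto simp: fun_eq_iff split: nat.split)
      then show ?thesis
        by (simp add: instS_def subst_subst subst_tm_Var)
    qed
    have env: "case_nat (ext X) (\<lambda>i. ext (\<rho> i)) = (\<lambda>i. ext (case_nat X \<rho> i))" for X
      by (auto simp: fun_eq_iff split: nat.split)
    show ?case
      by (simp add: env AllS.IH allS_iff inst)
  qed (simp_all add: eval v v_less v_ext imp_iff bot_notin)
  have "RCA0_model (v Zero) (v One) plus times less (range ext)"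
  proof
    show "range ext \<noteq> {}"
      by simp
  next
    fix \<chi> e and E :: "nat \<Rightarrow> nat set"
    assume \<chi>: "\<chi> \<in> RCA0_axioms" and E: "range E \<subseteq> range ext"
    obtain k where k: "free_below k k \<chi>"
      using free_below_exists by blast
    have "subst (\<lambda>i. w (e i)) (\<lambda>X. inv ext (E X)) \<chi> \<in> T"
      using closure_instance[of k k \<chi>] k \<chi> T unfolding RCA0_def by blast
    moreover have "ext (inv ext (E X)) = E X" for X
      using E by (meson f_inv_into_f range_subsetD)
    ultimately show "M.sat e E \<chi>"
      using truth[of "\<lambda>i. w (e i)" "\<lambda>X. inv ext (E X)" \<chi>] by (simp add: vw)
  qed
  moreover have "\<not> M.sat (\<lambda>i. v (Var i)) ext \<phi>"
    using truth[of Var "\<lambda>X. X" \<phi>] T by (simp add: subst_Var neg_iff)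
  ultimately show ?thesis
    by blast
qed

section \<open>Induction and comprehension in a model\<close>

lemma case_nat_1 [simp]: "case_nat a f (1::nat) = f 0"
  by (simp add: One_nat_def)

declare Delta00.intros [simp, intro]

lemma Delta00_subst: "Delta00 \<phi> \<Longrightarrow> Delta00 (subst \<sigma> \<rho> \<phi>)"
proof (induction arbitrary: \<sigma> \<rho> rule: Delta00.induct)
  case (BAll \<phi> t)
  have "subst_tm (lift_tms \<sigma>) (shift_tm 1 t) = shift_tm 1 (subst_tm \<sigma> t)"
    by (rule lift_shift)
  then show ?case
    using BAll.IH by simp
qed auto

text \<open>In a bounded quantifier the bound does not see the bound variable, as in \<^const>\<open>Delta00\<close>.\<close>

abbreviation BAll :: "tm \<Rightarrow> fm \<Rightarrow> fm" where
  "BAll t \<phi> \<equiv> AllN (Imp (Less (Var 0) (shift_tm 1 t)) \<phi>)"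

abbreviation BEx :: "tm \<Rightarrow> fm \<Rightarrow> fm" where
  "BEx t \<phi> \<equiv> Neg (BAll t (Neg \<phi>))"

context RCA0_model
begin

lemma eval_shift_1 [simp]: "eval (case_nat x e) (shift_tm 1 t) = eval e t"
  by (simp add: shift_tm_1 eval_subst)

lemma eval_shift_2 [simp]: "eval (case_nat x (case_nat y e)) (shift_tm 2 t) = eval e t"
  by (simp add: eval_shift)

lemma sat_instN: "sat e E (instN t \<phi>) \<longleftrightarrow> sat (case_nat (eval e t) e) E \<phi>"
proof -
  have "(\<lambda>i. eval e (case_nat t Var i)) = case_nat (eval e t) e"
    by (auto simp: fun_eq_iff split: nat.split)
  then show ?thesis
    by (simp add: instN_def sat_subst)
qed

text \<open>
  In applications \<open>P\<close> is a semantic predicate, \<open>e\<close> and \<open>E\<close> list its parameters, and the simplifier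
  verifies that the formula defines it. The default branch of an environment is used for its last
  parameter.
\<close>

lemma induction_sat:
  assumes "Sigma01 \<phi>" "range E \<subseteq> S" and P: "\<And>x. P x \<longleftrightarrow> sat (case_nat x e) E \<phi>"
    and "P \<zero>" "\<And>x. P x \<Longrightarrow> P (x \<oplus> \<one>)"
  shows "P x"
proof -
  have "(\<lambda>i. eval (case_nat x e) (case_nat (Add (Var 0) One) (\<lambda>i. Var (Suc i)) i))
      = case_nat (x \<oplus> \<one>) e" for x
    by (auto simp: fun_eq_iff split: nat.split)
  moreover have "induction_axiom \<phi> \<in> RCA0_axioms"
    using assms(1) unfolding RCA0_axioms_def by blast
  then have "sat e E (induction_axiom \<phi>)"
    using assms(2) by (rule axiom_true)
  ultimately have "sat (case_nat \<zero> e) E \<phi> \<Longrightarrow>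
      (\<And>x. sat (case_nat x e) E \<phi> \<Longrightarrow> sat (case_nat (x \<oplus> \<one>) e) E \<phi>) \<Longrightarrow> sat (case_nat x e) E \<phi>"
    by (simp add: induction_axiom_def sat_instN sat_subst)
  then show ?thesis
    using assms(4,5) unfolding P by blast
qed

lemma Sigma_induct:
  assumes "Delta00 \<theta>" "range E \<subseteq> S" "\<And>x. P x \<longleftrightarrow> (\<exists>y. sat (case_nat y (case_nat x e)) E \<theta>)"
    and "P \<zero>" "\<And>x. P x \<Longrightarrow> P (x \<oplus> \<one>)"
  shows "P x"
proof (rule induction_sat[of "ExN \<theta>" E P e])
  show "Sigma01 (ExN \<theta>)"
    using assms(1) unfolding Sigma01_def by blast
  show "P x \<longleftrightarrow> sat (case_nat x e) E (ExN \<theta>)" for x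
    unfolding assms(3) by simp
  show "P \<zero>"
    by fact
  show "P x \<Longrightarrow> P (x \<oplus> \<one>)" for x
    by (rule assms(5))
qed (rule assms(2))

text \<open>
  A vacuous number quantifier turns a \<^const>\<open>Delta00\<close> formula into a \<^const>\<open>Sigma01\<close> or
  \<^const>\<open>Pi01\<close> formula.
\<close>

lemma sat_shiftN: "sat (case_nat y e) E (shiftN \<theta>) \<longleftrightarrow> sat e E \<theta>"
  by (simp add: shiftN_def sat_subst)

lemma sat_shiftS: "sat e (case_nat X E) (shiftS \<theta>) \<longleftrightarrow> sat e E \<theta>"
  by (simp add: shiftS_def sat_subst)

lemma Delta00_shiftN: "Delta00 \<theta> \<Longrightarrow> Delta00 (shiftN \<theta>)"
  by (simp add: shiftN_def Delta00_subst)

lemma Delta_induct: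
  assumes "Delta00 \<theta>" "range E \<subseteq> S" "\<And>x. P x \<longleftrightarrow> sat (case_nat x e) E \<theta>"
    and "P \<zero>" "\<And>x. P x \<Longrightarrow> P (x \<oplus> \<one>)"
  shows "P x"
proof (rule Sigma_induct[of "shiftN \<theta>" E P e])
  show "Delta00 (shiftN \<theta>)"
    using assms(1) by (rule Delta00_shiftN)
  show "P x \<longleftrightarrow> (\<exists>y. sat (case_nat y (case_nat x e)) E (shiftN \<theta>))" for x
    unfolding assms(3) by (simp add: sat_shiftN)
  show "P \<zero>"
    by fact
  show "P x \<Longrightarrow> P (x \<oplus> \<one>)" for x
    by (rule assms(5))
qed (rule assms(2))

lemma comprehension:
  assumes "Delta00 \<theta>" "range E \<subseteq> S" "\<And>x. P x \<longleftrightarrow> sat (case_nat x e) E \<theta>"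
  shows "{x. P x} \<in> S"
proof -
  have "comprehension_axiom (ExN (shiftN \<theta>)) (AllN (shiftN \<theta>)) \<in> RCA0_axioms"
    using Delta00_shiftN[OF assms(1)] unfolding RCA0_axioms_def Sigma01_def Pi01_def by blast
  then have "sat e E (comprehension_axiom (ExN (shiftN \<theta>)) (AllN (shiftN \<theta>)))"
    using assms(2) by (rule axiom_true)
  then have "\<exists>X\<in>S. \<forall>x. x \<in> X \<longleftrightarrow> sat (case_nat x e) E \<theta>"
    by (simp add: comprehension_axiom_def sat_shiftN sat_shiftS iff_conv_conj_imp)
  then obtain X where "X \<in> S" "\<And>x. x \<in> X \<longleftrightarrow> P x"
    unfolding assms(3) by blast
  moreover from this(2) have "X = {x. P x}"
    by blast
  ultimately show ?thesis
    by blast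
qed

text \<open>
  The set environment of a formula without set variables still has to take values in \<open>S\<close>.
\<close>

definition some_set :: "'a set" where "some_set = (SOME X. X \<in> S)"

lemma some_set: "range (\<lambda>_. some_set) \<subseteq> S"
  using some_in_eq[of S] sets_nonempty by (simp add: some_set_def)

lemmas pure_induct = Delta_induct[OF _ some_set]

section \<open>Arithmetic in a model\<close>

lemma basic_axioms_true: "\<forall>\<phi>\<in>basic_axioms. sat (case_nat m (\<lambda>_. n)) (\<lambda>_. some_set) \<phi>"
  using axiom_true[OF _ some_set] unfolding RCA0_axioms_def by blast

lemma succ_nonzero: "n \<oplus> \<one> \<noteq> \<zero>"
  and succ_inject: "m \<oplus> \<one> = n \<oplus> \<one> \<Longrightarrow> m = n"
  and plus_zero: "m \<oplus> \<zero> = m"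
  and plus_succ: "m \<oplus> (n \<oplus> \<one>) = (m \<oplus> n) \<oplus> \<one>"
  and times_zero: "m \<otimes> \<zero> = \<zero>"
  and times_succ: "m \<otimes> (n \<oplus> \<one>) = m \<otimes> n \<oplus> m"
  and not_less_zero: "\<not> m \<prec> \<zero>"
  and less_succ: "m \<prec> n \<oplus> \<one> \<longleftrightarrow> m \<prec> n \<or> m = n"
  using basic_axioms_true[of m n] by (simp_all add: basic_axioms_def Let_def) blast+

lemma zero_plus: "\<zero> \<oplus> n = n"
  by (rule pure_induct[where \<theta> = "Eq (Add Zero (Var 0)) (Var 0)" and e = "\<lambda>_. \<zero>"])
    (simp_all add: plus_zero plus_succ)

lemma succ_plus: "(m \<oplus> \<one>) \<oplus> n = (m \<oplus> n) \<oplus> \<one>"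
  by (rule pure_induct[where \<theta> = "Eq (Add (Add (Var 1) One) (Var 0)) (Add (Add (Var 1) (Var 0)) One)"
        and e = "\<lambda>_. m" and x = n])
    (simp_all add: plus_zero plus_succ)

lemma plus_commute: "m \<oplus> n = n \<oplus> m"
  by (rule pure_induct[where \<theta> = "Eq (Add (Var 1) (Var 0)) (Add (Var 0) (Var 1))"
        and e = "\<lambda>_. m" and x = n])
    (simp_all add: plus_zero zero_plus plus_succ succ_plus)

lemma plus_assoc: "(a \<oplus> b) \<oplus> c = a \<oplus> (b \<oplus> c)"
  by (rule pure_induct[where \<theta> = "Eq (Add (Add (Var 1) (Var 2)) (Var 0)) (Add (Var 1) (Add (Var 2) (Var 0)))"
        and e = "case_nat a (\<lambda>_. b)" and x = c])
    (simp_all add: plus_zero plus_succ)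

lemma zero_times: "\<zero> \<otimes> n = \<zero>"
  by (rule pure_induct[where \<theta> = "Eq (Mul Zero (Var 0)) Zero" and e = "\<lambda>_. \<zero>" and x = n])
    (simp_all add: plus_zero times_zero times_succ)

lemma succ_times: "(m \<oplus> \<one>) \<otimes> n = m \<otimes> n \<oplus> n"
proof (rule pure_induct[where \<theta> = "Eq (Mul (Add (Var 1) One) (Var 0)) (Add (Mul (Var 1) (Var 0)) (Var 0))"
        and e = "\<lambda>_. m" and x = n])
  fix n
  assume IH: "(m \<oplus> \<one>) \<otimes> n = m \<otimes> n \<oplus> n"
  have "m \<otimes> n \<oplus> n \<oplus> m = m \<otimes> n \<oplus> m \<oplus> n"
    by (simp only: plus_assoc plus_commute[of n m])
  then show "(m \<oplus> \<one>) \<otimes> (n \<oplus> \<one>) = m \<otimes> (n \<oplus> \<one>) \<oplus> (n \<oplus> \<one>)"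
    by (simp add: times_succ IH plus_succ)
qed (simp_all add: times_zero plus_zero)

lemma times_commute: "m \<otimes> n = n \<otimes> m"
  by (rule pure_induct[where \<theta> = "Eq (Mul (Var 1) (Var 0)) (Mul (Var 0) (Var 1))"
        and e = "\<lambda>_. m" and x = n])
    (simp_all add: times_zero zero_times times_succ succ_times)

lemma times_plus: "a \<otimes> (b \<oplus> c) = a \<otimes> b \<oplus> a \<otimes> c"
  by (rule pure_induct[where \<theta> = "Eq (Mul (Var 1) (Add (Var 2) (Var 0))) (Add (Mul (Var 1) (Var 2)) (Mul (Var 1) (Var 0)))"
        and e = "case_nat a (\<lambda>_. b)" and x = c])
    (simp_all add: plus_zero times_zero times_succ plus_assoc[symmetric])

lemma times_assoc: "(a \<otimes> b) \<otimes> c = a \<otimes> (b \<otimes> c)"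
  by (rule pure_induct[where \<theta> = "Eq (Mul (Mul (Var 1) (Var 2)) (Var 0)) (Mul (Var 1) (Mul (Var 2) (Var 0)))"
        and e = "case_nat a (\<lambda>_. b)" and x = c])
    (simp_all add: times_zero times_succ times_plus[of a _ b])

lemma one_times: "\<one> \<otimes> n = n"
  using times_succ[of n \<zero>] by (simp add: times_commute[of \<one>] zero_plus times_zero)

lemma plus_cancel: "a \<oplus> c = b \<oplus> c \<Longrightarrow> a = b"
proof -
  have "a \<oplus> c = b \<oplus> c \<longrightarrow> a = b"
    by (rule pure_induct[where \<theta> = "Imp (Eq (Add (Var 1) (Var 0)) (Add (Var 2) (Var 0))) (Eq (Var 1) (Var 2))"
        and e = "case_nat a (\<lambda>_. b)" and x = c])
      (auto simp: plus_zero plus_succ dest: succ_inject)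
  then show "a \<oplus> c = b \<oplus> c \<Longrightarrow> a = b"
    by simp
qed

lemma zero_or_succ: "x = \<zero> \<or> (\<exists>y. x = y \<oplus> \<one>)"
  by (rule Sigma_induct[where \<theta> = "Or (Eq (Var 1) Zero) (Eq (Var 1) (Add (Var 0) One))"
        and e = "\<lambda>_. \<zero>" and x = x, OF _ some_set]) auto

lemma less_iff: "x \<prec> y \<longleftrightarrow> (\<exists>z. y = x \<oplus> z \<oplus> \<one>)"
proof -
  have "\<exists>z. x \<prec> y \<longrightarrow> y = x \<oplus> z \<oplus> \<one>"
  proof (rule Sigma_induct[where \<theta> = "Imp (Less (Var 2) (Var 1)) (Eq (Var 1) (Add (Add (Var 2) (Var 0)) One))"
        and e = "\<lambda>_. x" and x = y, OF _ some_set])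
    fix y
    assume "\<exists>z. x \<prec> y \<longrightarrow> y = x \<oplus> z \<oplus> \<one>"
    then obtain z where "x \<prec> y \<Longrightarrow> y = x \<oplus> z \<oplus> \<one>"
      by blast
    then show "\<exists>z. x \<prec> y \<oplus> \<one> \<longrightarrow> y \<oplus> \<one> = x \<oplus> z \<oplus> \<one>"
      unfolding less_succ by (metis plus_zero plus_succ)
  qed (simp_all add: not_less_zero)
  moreover have "x \<prec> x \<oplus> z \<oplus> \<one>" for z
    by (rule pure_induct[where \<theta> = "Less (Var 1) (Add (Add (Var 1) (Var 0)) One)"
        and e = "\<lambda>_. x" and x = z])
      (auto simp: plus_zero plus_succ less_succ)
  ultimately show ?thesis
    by blast
qed

definition less_eq :: "'a \<Rightarrow> 'a \<Rightarrow> bool" (infix "\<preceq>" 50) where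
  "x \<preceq> y \<longleftrightarrow> x \<prec> y \<or> x = y"

lemma less_eq_iff: "x \<preceq> y \<longleftrightarrow> (\<exists>z. y = x \<oplus> z)"
proof
  show "x \<preceq> y \<Longrightarrow> \<exists>z. y = x \<oplus> z"
    unfolding less_eq_def less_iff by (metis plus_assoc plus_zero)
  assume "\<exists>z. y = x \<oplus> z"
  then show "x \<preceq> y"
    unfolding less_eq_def less_iff by (metis plus_assoc plus_zero zero_or_succ)
qed

lemma plus_eq_zero: "x \<oplus> y = \<zero> \<Longrightarrow> y = \<zero>"
  by (metis plus_succ succ_nonzero zero_or_succ)

lemma plus_eq_self: "x \<oplus> y = x \<Longrightarrow> y = \<zero>"
  by (metis plus_cancel plus_commute plus_zero)

lemma less_irrefl': "\<not> x \<prec> x"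
  unfolding less_iff by (metis plus_assoc plus_eq_self succ_nonzero)

lemma less_trans': "x \<prec> y \<Longrightarrow> y \<prec> z \<Longrightarrow> x \<prec> z"
  unfolding less_iff by (metis plus_assoc)

lemma less_linear': "x \<prec> y \<or> x = y \<or> y \<prec> x"
proof (rule pure_induct[where \<theta> = "Or (Less (Var 1) (Var 0)) (Or (Eq (Var 1) (Var 0)) (Less (Var 0) (Var 1)))"
        and e = "\<lambda>_. x" and x = y])
  show "x \<prec> \<zero> \<or> x = \<zero> \<or> \<zero> \<prec> x"
    using zero_or_succ[of x] less_iff[of \<zero> x] by (metis zero_plus)
next
  fix y
  assume "x \<prec> y \<or> x = y \<or> y \<prec> x"
  moreover have "x = y \<oplus> \<one> \<or> y \<oplus> \<one> \<prec> x" if yx: "y \<prec> x"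
  proof -
    obtain z where z: "x = y \<oplus> z \<oplus> \<one>"
      using yx unfolding less_iff by blast
    show ?thesis
    proof (cases "z = \<zero>")
      case False
      then obtain w where "z = w \<oplus> \<one>"
        using zero_or_succ by blast
      then have "x = y \<oplus> \<one> \<oplus> w \<oplus> \<one>"
        by (simp only: z plus_succ succ_plus[of y w])
      then show ?thesis
        unfolding less_iff by blast
    qed (simp add: z plus_zero)
  qed
  ultimately show "x \<prec> y \<oplus> \<one> \<or> x = y \<oplus> \<one> \<or> y \<oplus> \<one> \<prec> x"
    unfolding less_succ by blast
qed auto

sublocale comm_semiring_1 "(\<otimes>)" \<one> "(\<oplus>)" \<zero>
proof
  show "\<zero> \<noteq> \<one>"
    using succ_nonzero[of \<zero>] by (simp add: zero_plus)
  show "(a \<oplus> b) \<otimes> c = a \<otimes> c \<oplus> b \<otimes> c" for a b c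
    by (simp add: times_commute[of _ c] times_plus)
qed (fact plus_assoc plus_commute zero_plus times_assoc times_commute one_times zero_times times_zero)+

sublocale linorder "(\<preceq>)" "(\<prec>)"
  by standard (use less_irrefl' less_trans' less_linear' in \<open>unfold less_eq_def, blast+\<close>)

text \<open>
  With truncated subtraction the model becomes an ordered semiring with cancellation in the sense of
  the library.
\<close>

definition minus :: "'a \<Rightarrow> 'a \<Rightarrow> 'a" (infixl "\<ominus>" 65) where
  "x \<ominus> y = (if y \<preceq> x then THE z. x = y \<oplus> z else \<zero>)"

lemma minus_plus: "(y \<oplus> z) \<ominus> y = z"
proof -
  have "(THE w. y \<oplus> z = y \<oplus> w) = z"
    by (rule the_equality) (use plus_cancel plus_commute in metis)+
  then show ?thesis
    by (auto simp: minus_def less_eq_iff)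
qed

lemma minus_less: "x \<prec> y \<Longrightarrow> x \<ominus> y = \<zero>"
  unfolding minus_def using leD by auto

lemma less_cases: obtains z where "x = y \<oplus> z" | "x \<prec> y"
  using less_eq_iff[of y x] not_le by blast

lemma plus_less_plus: "a \<oplus> b \<prec> a \<oplus> c \<longleftrightarrow> b \<prec> c"
proof
  show "b \<prec> c \<Longrightarrow> a \<oplus> b \<prec> a \<oplus> c"
    unfolding less_iff by (metis plus_assoc)
  assume "a \<oplus> b \<prec> a \<oplus> c"
  then obtain z where "c \<oplus> a = (b \<oplus> z \<oplus> \<one>) \<oplus> a"
    unfolding less_iff by (auto simp: algebra_simps)
  then show "b \<prec> c"
    unfolding less_iff using plus_cancel by blast
qed

lemma times_less_times: "a \<prec> b \<Longrightarrow> \<zero> \<prec> c \<Longrightarrow> c \<otimes> a \<prec> c \<otimes> b"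
proof -
  assume "a \<prec> b" "\<zero> \<prec> c"
  then obtain z w where "b = a \<oplus> z \<oplus> \<one>" "c = w \<oplus> \<one>"
    by (auto simp: less_iff)
  then have "c \<otimes> b = c \<otimes> a \<oplus> (w \<otimes> z \<oplus> w \<oplus> z) \<oplus> \<one>"
    by (simp add: algebra_simps)
  then show ?thesis
    unfolding less_iff by blast
qed

sublocale linordered_semidom "(\<oplus>)" "(\<ominus>)" "(\<preceq>)" "(\<prec>)" \<zero> "(\<otimes>)" \<one>
proof
  fix a b c :: 'a
  show "a \<oplus> b \<ominus> a = b"
    by (rule minus_plus)
  show "a \<ominus> b \<ominus> c = a \<ominus> (b \<oplus> c)"
  proof (cases rule: less_cases[of a b])
    case (1 z)
    then have "a \<ominus> b = z"
      by (simp add: minus_plus)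
    moreover have "z \<ominus> c = a \<ominus> (b \<oplus> c)"
    proof (cases rule: less_cases[of z c])
      case (1 w)
      then have "a = b \<oplus> c \<oplus> w"
        using \<open>a = b \<oplus> z\<close> by (simp add: plus_assoc)
      then show ?thesis
        using 1 by (simp only: minus_plus)
    next
      case 2
      then show ?thesis
        using \<open>a = b \<oplus> z\<close> by (simp add: minus_less plus_less_plus)
    qed
    ultimately show ?thesis
      by simp
  next
    case 2
    then have "a \<prec> b \<oplus> c"
      by (metis less_eq_iff less_le_trans)
    moreover have "\<zero> \<ominus> c = \<zero>"
      by (metis minus_def minus_plus less_eq_iff plus_eq_zero zero_plus)
    ultimately show ?thesis
      using 2 by (simp add: minus_less)
  qed
  show "a \<otimes> (b \<ominus> c) = a \<otimes> b \<ominus> a \<otimes> c"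
  proof (cases rule: less_cases[of b c])
    case (1 z)
    then show ?thesis
      by (simp add: minus_plus distrib_left)
  next
    case 2
    have "a \<otimes> b \<ominus> a \<otimes> c = \<zero>"
    proof (cases "a = \<zero>")
      case True
      then show ?thesis
        using minus_plus[of \<zero> \<zero>] by simp
    next
      case False
      then have "\<zero> \<prec> a"
        using zero_or_succ[of a] by (auto simp: less_iff)
      then show ?thesis
        using 2 by (intro minus_less times_less_times)
    qed
    then show ?thesis
      using 2 by (simp add: minus_less)
  qed
  show "\<zero> \<prec> \<one>"
    by (auto simp: less_iff intro!: exI[of _ \<zero>])
  show "a \<preceq> b \<Longrightarrow> c \<oplus> a \<preceq> c \<oplus> b"
    unfolding less_eq_iff by (metis plus_assoc)
  show "a \<prec> b \<Longrightarrow> \<zero> \<prec> c \<Longrightarrow> c \<otimes> a \<prec> c \<otimes> b"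
    by (rule times_less_times)
  show "b \<preceq> a \<Longrightarrow> a \<ominus> b \<oplus> b = a"
    unfolding less_eq_iff using minus_plus add.commute by metis
  show "a \<noteq> \<zero> \<Longrightarrow> b \<noteq> \<zero> \<Longrightarrow> a \<otimes> b \<noteq> \<zero>"
    by (metis zero_or_succ times_succ plus_eq_zero)
qed

end

context RCA0_model
begin

declare not_less_zero [simp]

lemma zero_least [simp]: "\<zero> \<preceq> x"
  by (auto simp: less_eq_iff)

lemma zero_less [simp]: "\<zero> \<prec> x \<longleftrightarrow> x \<noteq> \<zero>"
  using le_neq_trans[of \<zero> x] by auto

lemma le_zero [simp]: "x \<preceq> \<zero> \<longleftrightarrow> x = \<zero>"
  by (simp add: le_less)

lemma less_succ_iff [simp]: "x \<prec> y \<oplus> \<one> \<longleftrightarrow> x \<preceq> y"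
  by (auto simp: less_succ le_less)

lemma succ_le_iff: "x \<oplus> \<one> \<preceq> y \<longleftrightarrow> x \<prec> y"
  by (metis less_succ_iff not_le)

lemma nonzero_succ: "x \<noteq> \<zero> \<Longrightarrow> \<exists>y. x = y \<oplus> \<one>"
  using zero_or_succ by blast

lemma le_plus_right: "y \<preceq> x \<oplus> y"
  unfolding less_eq_iff using add.commute by blast

lemma le_plus_left: "x \<preceq> x \<oplus> y"
  unfolding less_eq_iff by blast

lemma le_multiple: "k \<noteq> \<zero> \<Longrightarrow> x \<preceq> k \<otimes> x"
  by (metis less_eq_iff nonzero_succ succ_times add.commute)

text \<open>
  Otherwise \<^const>\<open>Delta00\<close> induction shows that no number has a predecessor in \<open>X\<close>.
\<close>

lemma least_element:
  assumes "X \<in> S" "a \<in> X"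
  shows "\<exists>m\<in>X. \<forall>x\<in>X. m \<preceq> x"
proof (rule ccontr)
  assume no_least: "\<not> ?thesis"
  have "\<forall>x. x \<prec> n \<longrightarrow> x \<notin> X" for n
  proof (rule Delta_induct[where \<theta> = "BAll (Var 0) (Neg (Mem (Var 0) 0))" and E = "\<lambda>_. X"
        and e = "\<lambda>_. \<zero>" and x = n and P = "\<lambda>n. \<forall>x. x \<prec> n \<longrightarrow> x \<notin> X"])
    fix n
    assume below: "\<forall>x. x \<prec> n \<longrightarrow> x \<notin> X"
    then have "n \<notin> X"
      using no_least not_le by blast
    then show "\<forall>x. x \<prec> n \<oplus> \<one> \<longrightarrow> x \<notin> X"
      using below by (auto simp: le_less)
  qed (use \<open>X \<in> S\<close> in auto)
  then show False
    using \<open>a \<in> X\<close> less_succ_iff by blast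
qed

section \<open>Pairs and codes of finite sets\<close>

definition pr :: "'a \<Rightarrow> 'a \<Rightarrow> 'a" where
  "pr x y = (x \<oplus> y) \<otimes> (x \<oplus> y) \<oplus> x"

lemma eval_pair [simp]: "eval e (pair s t) = pr (eval e s) (eval e t)"
  by (simp add: pair_def pr_def)

lemma pr_mono: "x \<preceq> x' \<Longrightarrow> y \<preceq> y' \<Longrightarrow> pr x y \<preceq> pr x' y'"
  unfolding pr_def by (intro add_mono mult_mono) simp_all

text \<open>
  The square of \<open>s + 1\<close> exceeds the square of \<open>s\<close> by more than \<open>s\<close>, and \<open>x \<le> s\<close> for \<open>s = x + y\<close>.
\<close>

lemma pr_less: "x \<oplus> y \<prec> x' \<oplus> y' \<Longrightarrow> pr x y \<prec> pr x' y'"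
proof -
  define s where "s = x \<oplus> y"
  assume "x \<oplus> y \<prec> x' \<oplus> y'"
  then obtain z where z: "x' \<oplus> y' = s \<oplus> z \<oplus> \<one>"
    by (auto simp: less_iff s_def)
  have "pr x' y' = s \<otimes> s \<oplus> x \<oplus> (y \<oplus> s \<oplus> (z \<otimes> s \<oplus> z \<otimes> s \<oplus> z \<otimes> z \<oplus> z \<oplus> z \<oplus> x')) \<oplus> \<one>"
    unfolding pr_def z by (simp add: s_def algebra_simps)
  then show ?thesis
    unfolding pr_def less_iff s_def by blast
qed

lemma pr_inject [simp]: "pr x y = pr x' y' \<longleftrightarrow> x = x' \<and> y = y'"
proof
  assume eq: "pr x y = pr x' y'"
  then have "x \<oplus> y = x' \<oplus> y'"
    using pr_less less_irrefl less_linear by metis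
  then show "x = x' \<and> y = y'"
    using eq by (auto simp: pr_def)
qed auto

definition divides :: "'a \<Rightarrow> 'a \<Rightarrow> bool" where
  "divides x y \<longleftrightarrow> (\<exists>k. y = x \<otimes> k)"

lemma divides_times: "divides x y \<Longrightarrow> divides x (y \<otimes> z)"
  unfolding divides_def by (metis mult.assoc)

lemma divides_plus_cancel:
  assumes "divides x (y \<oplus> z)" "divides x y" "x \<noteq> \<zero>"
  shows "divides x z"
proof -
  obtain k l where k: "y \<oplus> z = x \<otimes> k" and l: "y = x \<otimes> l"
    using assms(1,2) by (auto simp: divides_def)
  have "x \<otimes> l \<preceq> x \<otimes> k"
    unfolding k[symmetric] l less_eq_iff by blast
  then have "\<not> k \<prec> l"
    using mult_strict_left_mono[of k l x] assms(3) leD zero_less by blast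
  then obtain w where "k = l \<oplus> w"
    using less_eq_iff not_less by blast
  then show ?thesis
    using k l by (auto simp: divides_def distrib_left)
qed

text \<open>
  A finite set is coded by two numbers: \<open>z\<close> belongs to the set if \<open>1 + (z + 1) d\<close> divides \<open>m\<close>. If all
  positive numbers up to \<open>b\<close> divide \<open>d\<close>, the divisors for \<open>z < b\<close> are pairwise coprime, so that every
  set of numbers below \<open>b\<close> has a code of the form \<open>(d, m)\<close>.
\<close>

definition code :: "'a \<Rightarrow> 'a \<Rightarrow> 'a \<Rightarrow> bool" where
  "code d m z \<longleftrightarrow> divides (\<one> \<oplus> (z \<oplus> \<one>) \<otimes> d) m"

text \<open>
  A substitute for the factorial of \<open>b\<close>, whose definition would need coded sequences.
\<close>

lemma common_multiple: "\<exists>d. d \<noteq> \<zero> \<and> (\<forall>k. k \<noteq> \<zero> \<longrightarrow> k \<preceq> b \<longrightarrow> divides k d)"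
proof -
  have bounded: "divides k d \<longleftrightarrow> (\<exists>q. q \<preceq> d \<and> d = k \<otimes> q)" if "k \<noteq> \<zero>" for k d
    using le_multiple[OF that] by (auto simp: divides_def)
  show ?thesis
  proof (rule Sigma_induct[where \<theta> = "And (Less Zero (Var 0)) (BAll (Add (Var 1) One) (Imp (Less Zero (Var 0))
            (BEx (Add (Var 1) One) (Eq (Var 2) (Mul (Var 1) (Var 0))))))"
        and e = "\<lambda>_. \<zero>" and x = b
        and P = "\<lambda>b. \<exists>d. d \<noteq> \<zero> \<and> (\<forall>k. k \<noteq> \<zero> \<longrightarrow> k \<preceq> b \<longrightarrow> divides k d)", OF _ some_set])
    fix b
    assume "\<exists>d. d \<noteq> \<zero> \<and> (\<forall>k. k \<noteq> \<zero> \<longrightarrow> k \<preceq> b \<longrightarrow> divides k d)"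
    then obtain d where d: "d \<noteq> \<zero>" "\<And>k. k \<noteq> \<zero> \<Longrightarrow> k \<preceq> b \<Longrightarrow> divides k d"
      by blast
    have "divides k (d \<otimes> (b \<oplus> \<one>))" if "k \<noteq> \<zero>" "k \<preceq> b \<oplus> \<one>" for k
    proof (cases "k = b \<oplus> \<one>")
      case True
      then show ?thesis
        by (auto simp: divides_def mult.commute)
    next
      case False
      then have "k \<preceq> b"
        using that(2) by (simp add: le_less)
      then show ?thesis
        using d that divides_times by blast
    qed
    moreover have "d \<otimes> (b \<oplus> \<one>) \<noteq> \<zero>"
      using d(1) succ_nonzero by simp
    ultimately show "\<exists>d. d \<noteq> \<zero> \<and> (\<forall>k. k \<noteq> \<zero> \<longrightarrow> k \<preceq> b \<oplus> \<one> \<longrightarrow> divides k d)"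
      by blast
  next
    show "\<exists>d. d \<noteq> \<zero> \<and> (\<forall>k. k \<noteq> \<zero> \<longrightarrow> k \<preceq> \<zero> \<longrightarrow> divides k d)"
      by (rule exI[of _ \<one>]) simp
  qed (auto simp: bounded)
qed

text \<open>
  The two divisors \<open>1 + (x + 1) d\<close> and \<open>1 + (y + 1) d\<close> differ by a multiple \<open>e d\<close> of \<open>d\<close> with
  \<open>0 < e \<le> b\<close>. So the first one, \<open>p\<close>, divides \<open>m e d\<close>. Here \<open>d\<close> can be cancelled since it is invertible
  modulo \<open>p\<close>, and \<open>e\<close> can be cancelled because it divides \<open>d\<close>. This avoids Bezout coefficients and prime
  factors.
\<close>

lemma coprime_divisors:
  assumes d: "\<And>k. k \<noteq> \<zero> \<Longrightarrow> k \<preceq> b \<Longrightarrow> divides k d"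
    and "x \<prec> b" "y \<prec> b" "x \<noteq> y" and code: "code d (m \<otimes> (\<one> \<oplus> (y \<oplus> \<one>) \<otimes> d)) x"
  shows "code d m x"
proof -
  define p where "p = \<one> \<oplus> (x \<oplus> \<one>) \<otimes> d"
  have p: "p \<noteq> \<zero>"
    unfolding p_def by (metis add.commute succ_nonzero)
  \<comment> \<open>\<open>p\<close> is coprime to \<open>d\<close>, as \<open>p - (x + 1) d = 1\<close>\<close>
  have drop_d: "divides p z" if "divides p (z \<otimes> d)" for z
  proof (rule divides_plus_cancel[OF _ _ p])
    show "divides p (z \<otimes> d \<otimes> (x \<oplus> \<one>))"
      using that by (rule divides_times)
    have "z \<otimes> d \<otimes> (x \<oplus> \<one>) \<oplus> z = p \<otimes> z"
      by (simp add: p_def algebra_simps)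
    then show "divides p (z \<otimes> d \<otimes> (x \<oplus> \<one>) \<oplus> z)"
      by (auto simp: divides_def)
  qed
  have cancel: "divides p m" if e: "divides p (m \<otimes> (e \<otimes> d))" "e \<noteq> \<zero>" "e \<preceq> b" for e
  proof -
    have "divides p (m \<otimes> e)"
      using e(1) drop_d[of "m \<otimes> e"] by (simp add: mult.assoc)
    moreover obtain f where "d = e \<otimes> f"
      using d e unfolding divides_def by blast
    ultimately have "divides p (m \<otimes> d)"
      using divides_times[of p "m \<otimes> e" f] by (simp add: mult.assoc)
    then show ?thesis
      by (rule drop_d)
  qed
  consider e where "y = x \<oplus> e" | e where "x = y \<oplus> e"
    using less_eq_iff linear by metis
  then have "divides p m"
  proof cases
    case (1 e)
    have "m \<otimes> (\<one> \<oplus> (y \<oplus> \<one>) \<otimes> d) = m \<otimes> p \<oplus> m \<otimes> (e \<otimes> d)"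
      unfolding 1 p_def by (simp add: algebra_simps)
    then have "divides p (m \<otimes> p \<oplus> m \<otimes> (e \<otimes> d))"
      using code by (simp add: code_def p_def)
    moreover have "divides p (m \<otimes> p)"
      by (auto simp: divides_def mult.commute)
    moreover have "e \<noteq> \<zero>"
      using 1 assms(4) by auto
    moreover have "e \<preceq> b"
      using 1 assms(2,3) le_plus_right less_imp_le order_trans by metis
    ultimately show ?thesis
      using cancel divides_plus_cancel p by blast
  next
    case (2 e)
    have "p \<otimes> m = m \<otimes> (\<one> \<oplus> (y \<oplus> \<one>) \<otimes> d) \<oplus> m \<otimes> (e \<otimes> d)"
      unfolding 2 p_def by (simp add: algebra_simps)
    then have "divides p (m \<otimes> (\<one> \<oplus> (y \<oplus> \<one>) \<otimes> d) \<oplus> m \<otimes> (e \<otimes> d))"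
      unfolding divides_def by metis
    moreover have "divides p (m \<otimes> (\<one> \<oplus> (y \<oplus> \<one>) \<otimes> d))"
      using code by (simp add: code_def p_def)
    moreover have "e \<noteq> \<zero>"
      using 2 assms(4) by auto
    moreover have "e \<preceq> b"
      using 2 assms(2,3) le_plus_right less_imp_le order_trans by metis
    ultimately show ?thesis
      using cancel divides_plus_cancel p by blast
  qed
  then show ?thesis
    by (simp add: code_def p_def)
qed

end

definition CodeF :: "tm \<Rightarrow> tm \<Rightarrow> tm \<Rightarrow> fm" where
  "CodeF d m z = BEx (Add m One)
    (Eq (shift_tm 1 m) (Mul (Add One (Mul (Add (shift_tm 1 z) One) (shift_tm 1 d))) (Var 0)))"

lemma Delta00_CodeF [simp]: "Delta00 (CodeF d m z)"
  by (simp add: CodeF_def)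

context RCA0_model
begin

lemma sat_CodeF [simp]: "sat e E (CodeF d m z) \<longleftrightarrow> code (eval e d) (eval e m) (eval e z)"
proof -
  define p where "p = \<one> \<oplus> (eval e z \<oplus> \<one>) \<otimes> eval e d"
  have "p \<noteq> \<zero>"
    unfolding p_def by (metis add.commute succ_nonzero)
  then have "divides p y \<longleftrightarrow> (\<exists>k. k \<preceq> y \<and> y = p \<otimes> k)" for y
    using le_multiple unfolding divides_def by metis
  then show ?thesis
    by (simp add: CodeF_def code_def flip: p_def)
qed

text \<open>
  The number \<open>m\<close> is the product of the divisors belonging to the elements of the set; it is built by
  \<^const>\<open>Sigma01\<close> induction, one element at a time.
\<close>

lemma code_exists:
  assumes "X \<in> S"
  shows "\<exists>d m. \<forall>z. z \<prec> b \<longrightarrow> (z \<in> X \<longleftrightarrow> code d m z)"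
proof -
  obtain d where "d \<noteq> \<zero>" and d: "\<And>k. k \<noteq> \<zero> \<Longrightarrow> k \<preceq> b \<Longrightarrow> divides k d"
    using common_multiple by blast
  have "\<exists>m. \<forall>z. z \<prec> b \<longrightarrow> (z \<in> X \<and> z \<prec> c \<longleftrightarrow> code d m z)" for c
  proof (rule Sigma_induct[where e = "case_nat b (\<lambda>_. d)" and E = "\<lambda>_. X" and x = c
        and \<theta> = "BAll (Var 2) (Iff (And (Mem (Var 0) 0) (Less (Var 0) (Var 2))) (CodeF (Var 4) (Var 1) (Var 0)))"
        and P = "\<lambda>c. \<exists>m. \<forall>z. z \<prec> b \<longrightarrow> (z \<in> X \<and> z \<prec> c \<longleftrightarrow> code d m z)"])
    have "\<not> code d \<one> z" for z
    proof
      assume "code d \<one> z"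
      then obtain k where k: "\<one> = (\<one> \<oplus> (z \<oplus> \<one>) \<otimes> d) \<otimes> k"
        by (auto simp: code_def divides_def)
      then obtain l where "k = l \<oplus> \<one>"
        using nonzero_succ[of k] by fastforce
      then have "\<one> = \<one> \<oplus> (l \<oplus> (z \<oplus> \<one>) \<otimes> d \<otimes> l \<oplus> z \<otimes> d \<oplus> d)"
        using k by (simp add: algebra_simps)
      then show False
        using \<open>d \<noteq> \<zero>\<close> plus_eq_self plus_eq_zero by metis
    qed
    then show "\<exists>m. \<forall>z. z \<prec> b \<longrightarrow> (z \<in> X \<and> z \<prec> \<zero> \<longleftrightarrow> code d m z)"
      using not_less_zero by blast
  next
    fix c
    assume "\<exists>m. \<forall>z. z \<prec> b \<longrightarrow> (z \<in> X \<and> z \<prec> c \<longleftrightarrow> code d m z)"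
    then obtain m where m: "\<And>z. z \<prec> b \<Longrightarrow> z \<in> X \<and> z \<prec> c \<longleftrightarrow> code d m z"
      by blast
    show "\<exists>m. \<forall>z. z \<prec> b \<longrightarrow> (z \<in> X \<and> z \<prec> c \<oplus> \<one> \<longleftrightarrow> code d m z)"
    proof (cases "c \<in> X \<and> c \<prec> b")
      case True
      define q where "q = \<one> \<oplus> (c \<oplus> \<one>) \<otimes> d"
      have "z \<in> X \<and> z \<preceq> c \<longleftrightarrow> code d (m \<otimes> q) z" if "z \<prec> b" for z
      proof (cases "z = c")
        case True
        then show ?thesis
          using \<open>c \<in> X \<and> c \<prec> b\<close> by (auto simp: code_def q_def divides_def mult.commute)
      next
        case False
        have "code d (m \<otimes> q) z \<longleftrightarrow> code d m z"
          using coprime_divisors[OF d \<open>z \<prec> b\<close> _ False, of m] True divides_times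
          by (auto simp: code_def q_def)
        then show ?thesis
          using m[OF that] False by (simp add: le_less)
      qed
      then show ?thesis
        by auto
    next
      case False
      then have "\<forall>z. z \<prec> b \<longrightarrow> (z \<in> X \<and> z \<prec> c \<oplus> \<one> \<longleftrightarrow> code d m z)"
        using m by (auto simp: le_less)
      then show ?thesis
        by blast
    qed
  qed (use assms in \<open>auto simp: iff_conv_conj_imp\<close>)
  from this[of b] show ?thesis
    by blast
qed

end

section \<open>The sequence of lengths\<close>

definition GoodF :: "tm \<Rightarrow> tm \<Rightarrow> fm" where
  "GoodF s t = And (Less Zero s) (BEx (Add t One) (And (Eq (shift_tm 1 t) (Mul (shift_tm 1 s) (Var 0)))
    (BAll (Add (Add (shift_tm 1 s) (shift_tm 1 s)) One) (BEx (Var 1) (Mem (pair (Var 1) (Var 0)) 0)))))"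

lemma Delta00_GoodF [simp]: "Delta00 (GoodF s t)"
  by (simp add: GoodF_def)

context RCA0_model
begin

text \<open>
  An interval of length \<open>n'\<close> splits into \<open>K\<close> blocks of length \<open>n\<close>. Choosing one element in each block
  yields gaps of at most \<open>2 n\<close>, and \<open>K\<close> exceeds the value of \<open>F\<close> at every gap size of this kind.
\<close>

definition good :: "'a set \<Rightarrow> 'a \<Rightarrow> 'a \<Rightarrow> bool" where
  "good F n n' \<longleftrightarrow> n \<noteq> \<zero> \<and> (\<exists>K. n' = n \<otimes> K \<and> (\<forall>x. x \<preceq> n \<oplus> n \<longrightarrow> (\<exists>y. y \<prec> K \<and> pr x y \<in> F)))"

text \<open>
  The predicate \<open>A\<close> stands for a coded set of pairs \<open>(i, n)\<close>, where \<open>n\<close> is a length such that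
  colourings with \<open>i\<close> colours of an interval of length \<open>n\<close> have a large homogeneous set, and \<open>N\<close> is the
  length for \<open>r\<close> colours. The recursion is read downwards: a length for \<open>i + 1\<close> colours comes from a
  length for \<open>i\<close> colours. In this form all quantifiers are bounded by \<open>r\<close> and \<open>N\<close>. For \<open>i = 0\<close> every
  positive length will do, as a nonempty interval has no colouring without colours.
\<close>

definition tower :: "'a set \<Rightarrow> 'a \<Rightarrow> 'a \<Rightarrow> ('a \<Rightarrow> bool) \<Rightarrow> bool" where
  "tower F r N A \<longleftrightarrow> A (pr r N) \<and> N \<noteq> \<zero> \<and> \<not> A (pr \<zero> \<zero>) \<and>
     (\<forall>i. i \<prec> r \<longrightarrow> (\<forall>n'. n' \<preceq> N \<longrightarrow> A (pr (i \<oplus> \<one>) n') \<longrightarrow> (\<exists>n. n \<preceq> n' \<and> A (pr i n) \<and> good F n n')))"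

lemma sat_GoodF [simp]: "E 0 = F \<Longrightarrow> sat e E (GoodF s t) \<longleftrightarrow> good F (eval e s) (eval e t)"
proof -
  assume "E 0 = F"
  have "K \<preceq> n'" if "n \<noteq> \<zero>" "n' = n \<otimes> K" for n n' K
    using that le_multiple by simp
  then show ?thesis
    using \<open>E 0 = F\<close> by (auto simp: GoodF_def good_def)
qed

text \<open>
  The bounding principle for a total relation, by \<^const>\<open>Sigma01\<close> induction on \<open>N\<close>.
\<close>

lemma bounded_range:
  assumes "F \<in> S" "\<And>x. \<exists>y. pr x y \<in> F"
  shows "\<exists>K. \<forall>x. x \<prec> N \<longrightarrow> (\<exists>y. y \<prec> K \<and> pr x y \<in> F)"
proof (rule Sigma_induct[where e = "\<lambda>_. \<zero>" and E = "\<lambda>_. F" and x = N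
      and \<theta> = "BAll (Var 1) (BEx (Var 1) (Mem (pair (Var 1) (Var 0)) 0))"
      and P = "\<lambda>N. \<exists>K. \<forall>x. x \<prec> N \<longrightarrow> (\<exists>y. y \<prec> K \<and> pr x y \<in> F)"])
  fix N
  assume "\<exists>K. \<forall>x. x \<prec> N \<longrightarrow> (\<exists>y. y \<prec> K \<and> pr x y \<in> F)"
  then obtain K where K: "\<And>x. x \<prec> N \<Longrightarrow> \<exists>y. y \<prec> K \<and> pr x y \<in> F"
    by blast
  obtain y where y: "pr N y \<in> F"
    using assms(2) by blast
  show "\<exists>K. \<forall>x. x \<prec> N \<oplus> \<one> \<longrightarrow> (\<exists>y. y \<prec> K \<and> pr x y \<in> F)"
  proof (rule exI[of _ "max K (y \<oplus> \<one>)"], intro allI impI)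
    fix x
    assume "x \<prec> N \<oplus> \<one>"
    then consider "x \<prec> N" | "x = N"
      by (auto simp: le_less)
    then show "\<exists>z. z \<prec> max K (y \<oplus> \<one>) \<and> pr x z \<in> F"
    proof cases
      case 1
      then show ?thesis
        using K less_max_iff_disj by blast
    next
      case 2
      then show ?thesis
        using y less_max_iff_disj less_succ_iff by blast
    qed
  qed
qed (use assms(1) in auto)

text \<open>
  A new element needs a new code, since the modulus \<open>d\<close> of the old one may be too small; comprehension
  first produces the enlarged set.
\<close>

lemma tower_step:
  assumes F: "F \<in> S" "\<And>x. \<exists>y. pr x y \<in> F" and tower: "tower F r N (code d m)"
  shows "\<exists>N' d' m'. tower F (r \<oplus> \<one>) N' (code d' m')"
proof -
  obtain K where K: "\<And>x. x \<preceq> N \<oplus> N \<Longrightarrow> \<exists>y. y \<prec> K \<and> pr x y \<in> F"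
    using bounded_range[OF F, of "N \<oplus> N \<oplus> \<one>"] by auto
  have "K \<noteq> \<zero>"
    using K[of \<zero>] by auto
  define N' where "N' = N \<otimes> K"
  have N: "N \<noteq> \<zero>"
    using tower by (simp add: tower_def)
  have good: "good F N N'"
    using N K by (auto simp: good_def N'_def)
  have "N \<preceq> N'"
    unfolding N'_def mult.commute[of N] using \<open>K \<noteq> \<zero>\<close> by (rule le_multiple)
  \<comment> \<open>the old code may contain further elements, which have to be removed\<close>
  define X where "X = {z. code d m z \<and> (\<exists>i. i \<preceq> r \<and> (\<exists>n. n \<preceq> N \<and> z = pr i n)) \<or> z = pr (r \<oplus> \<one>) N'}"
  have "X \<in> S"
    unfolding X_def
    by (rule comprehension[where E = "\<lambda>_. F"
          and e = "case_nat r (case_nat N (case_nat d (case_nat m (\<lambda>_. N'))))"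
          and \<theta> = "Or (And (CodeF (Var 3) (Var 4) (Var 0))
              (BEx (Add (Var 1) One) (BEx (Add (Var 3) One) (Eq (Var 2) (pair (Var 1) (Var 0))))))
            (Eq (Var 0) (pair (Add (Var 1) One) (Var 5)))"])
      (use F in auto)
  then obtain d' m' where "\<And>z. z \<prec> pr (r \<oplus> \<one>) N' \<oplus> \<one> \<Longrightarrow> z \<in> X \<longleftrightarrow> code d' m' z"
    using code_exists by meson
  then have code': "code d' m' (pr i n) \<longleftrightarrow> pr i n \<in> X" if "i \<preceq> r \<oplus> \<one>" "n \<preceq> N'" for i n
    using that pr_mono by simp
  have X: "pr i n \<in> X \<longleftrightarrow> code d m (pr i n) \<and> i \<preceq> r \<and> n \<preceq> N \<or> i = r \<oplus> \<one> \<and> n = N'" for i n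
    by (auto simp: X_def)
  have "tower F (r \<oplus> \<one>) N' (code d' m')"
    unfolding tower_def
  proof (intro conjI allI impI)
    show "code d' m' (pr (r \<oplus> \<one>) N')"
      by (simp add: code' X)
    show "N' \<noteq> \<zero>"
      using N \<open>K \<noteq> \<zero>\<close> by (simp add: N'_def)
  next
    show "\<not> code d' m' (pr \<zero> \<zero>)"
      using tower succ_nonzero[of r] by (auto simp: code' X tower_def)
  next
    fix i n'
    assume i: "i \<prec> r \<oplus> \<one>" and n': "n' \<preceq> N'" "code d' m' (pr (i \<oplus> \<one>) n')"
    then have i': "i \<preceq> r"
      by simp
    then have "pr (i \<oplus> \<one>) n' \<in> X"
      using n' by (simp add: code')
    then consider "code d m (pr (i \<oplus> \<one>) n')" "i \<prec> r" "n' \<preceq> N" | "i = r" "n' = N'"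
      by (auto simp: X succ_le_iff)
    then show "\<exists>n. n \<preceq> n' \<and> code d' m' (pr i n) \<and> good F n n'"
    proof cases
      case 1
      then obtain n where "n \<preceq> n'" "code d m (pr i n)" "good F n n'"
        using tower unfolding tower_def by blast
      moreover have "n \<preceq> N" "n \<preceq> N'" "i \<preceq> r \<oplus> \<one>"
        using \<open>n \<preceq> n'\<close> \<open>n' \<preceq> N\<close> n'(1) i order_trans less_imp_le by blast+
      ultimately show ?thesis
        using i' by (auto simp: code' X)
    next
      case 2
      moreover have "code d m (pr r N)"
        using tower by (simp add: tower_def)
      moreover have "r \<preceq> r \<oplus> \<one>"
        using i' by (simp add: less_imp_le)
      ultimately show ?thesis
        using \<open>N \<preceq> N'\<close> good by (auto simp: code' X)
    qed
  qed
  then show ?thesis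
    by blast
qed

text \<open>
  The induction formula is \<^const>\<open>Sigma01\<close> since the three existential quantifiers can be bounded by
  a single unbounded one. This is the step for which finite sets have to be coded by numbers: a set
  quantifier is not allowed here.
\<close>

lemma tower_exists:
  assumes F: "F \<in> S" "\<And>x. \<exists>y. pr x y \<in> F"
  shows "\<exists>N d m. tower F r N (code d m)"
proof -
  have bound: "(\<exists>N d m. Q N d m) \<longleftrightarrow> (\<exists>w. \<exists>N. N \<prec> w \<and> (\<exists>d. d \<prec> w \<and> (\<exists>m. m \<prec> w \<and> Q N d m)))" for Q
  proof
    assume "\<exists>N d m. Q N d m"
    then obtain N d m where "Q N d m"
      by blast
    moreover have "N \<prec> N \<oplus> d \<oplus> m \<oplus> \<one>" "d \<prec> N \<oplus> d \<oplus> m \<oplus> \<one>" "m \<prec> N \<oplus> d \<oplus> m \<oplus> \<one>"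
      unfolding less_succ_iff using less_eq_iff order_trans le_plus_right by blast+
    ultimately show "\<exists>w. \<exists>N. N \<prec> w \<and> (\<exists>d. d \<prec> w \<and> (\<exists>m. m \<prec> w \<and> Q N d m))"
      by blast
  qed blast
  show ?thesis
  proof (rule Sigma_induct[where e = "\<lambda>_. \<zero>" and E = "\<lambda>_. F" and x = r
        and P = "\<lambda>r. \<exists>N d m. tower F r N (code d m)"
        and \<theta> = "BEx (Var 0) (BEx (Var 1) (BEx (Var 2)
          (And (CodeF (Var 1) (Var 0) (pair (Var 4) (Var 2)))
          (And (Less Zero (Var 2))
          (And (Neg (CodeF (Var 1) (Var 0) (pair Zero Zero)))
               (BAll (Var 4) (BAll (Add (Var 3) One)
                 (Imp (CodeF (Var 3) (Var 2) (pair (Add (Var 1) One) (Var 0)))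
                   (BEx (Add (Var 0) One)
                     (And (CodeF (Var 4) (Var 3) (pair (Var 2) (Var 0))) (GoodF (Var 0) (Var 1))))))))))))"])
    define X where "X = {z. z = pr \<zero> \<one>}"
    have "X \<in> S"
      unfolding X_def
      by (rule comprehension[where E = "\<lambda>_. F" and e = "\<lambda>_. \<zero>" and \<theta> = "Eq (Var 0) (pair Zero One)"])
        (use F in auto)
    then obtain d m where dm: "\<And>z. z \<prec> pr \<zero> \<one> \<oplus> \<one> \<Longrightarrow> z \<in> X \<longleftrightarrow> code d m z"
      using code_exists by meson
    have "code d m (pr \<zero> n) \<longleftrightarrow> n = \<one>" if "n \<preceq> \<one>" for n
      using that pr_mono[of \<zero> \<zero> n \<one>] dm[of "pr \<zero> n"] by (simp add: X_def)
    then have "tower F \<zero> \<one> (code d m)"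
      by (auto simp: tower_def)
    then show "\<exists>N d m. tower F \<zero> N (code d m)"
      by blast
  next
    show "\<exists>N d m. tower F (r \<oplus> \<one>) N (code d m)" if "\<exists>N d m. tower F r N (code d m)" for r
      using that tower_step F by blast
  qed (unfold bound, use F(1) in \<open>simp_all add: tower_def image_subset_iff\<close>)
qed

section \<open>Blocks containing a fixed colour\<close>

text \<open>
  Take the least \<open>i\<close> such that some interval whose length belongs to \<open>i\<close> in the tower uses only colours
  below \<open>i\<close>. Since no interval of positive length is free of colours, \<open>i = j + 1\<close>, and the length is
  \<open>n K\<close> for some \<open>n\<close> belonging to \<open>j\<close>. By minimality each subinterval of length \<open>n\<close> contains a colour that
  is not below \<open>j\<close>, which can only be \<open>j\<close> itself.
\<close>

lemma dense_colour:
  assumes "F \<in> S" "C \<in> S" and tower: "tower F r N (code d m)"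
    and colour: "\<And>x. x \<prec> N \<Longrightarrow> \<exists>y. y \<prec> r \<and> pr x y \<in> C"
  shows "\<exists>a n K i. a \<oplus> n \<otimes> K \<preceq> N \<and> n \<noteq> \<zero>
    \<and> (\<forall>x. x \<preceq> n \<oplus> n \<longrightarrow> (\<exists>y. y \<prec> K \<and> pr x y \<in> F))
    \<and> (\<forall>b. a \<preceq> b \<longrightarrow> b \<oplus> n \<preceq> a \<oplus> n \<otimes> K \<longrightarrow> (\<exists>x. x \<prec> n \<and> pr (b \<oplus> x) i \<in> C))"
proof -
  define few where "few a n i \<longleftrightarrow> (\<forall>x. x \<prec> n \<longrightarrow> (\<exists>y. y \<prec> i \<and> pr (a \<oplus> x) y \<in> C))" for a n i
  define I where "I = {i. \<exists>a. a \<preceq> N \<and> (\<exists>n. n \<preceq> N \<and> code d m (pr i n) \<and> a \<oplus> n \<preceq> N \<and> few a n i)}"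
  have "I \<in> S"
    unfolding I_def few_def
    by (rule comprehension[where E = "\<lambda>_. C" and e = "case_nat N (case_nat d (\<lambda>_. m))"
          and \<theta> = "BEx (Add (Var 1) One) (BEx (Add (Var 2) One)
              (And (CodeF (Var 4) (Var 5) (pair (Var 2) (Var 0)))
              (And (Less (Add (Var 1) (Var 0)) (Add (Var 3) One))
                (BAll (Var 0) (BEx (Var 3) (Mem (pair (Add (Var 3) (Var 1)) (Var 0)) 0))))))"])
      (use \<open>C \<in> S\<close> in auto)
  have memI: "i \<in> I \<longleftrightarrow> (\<exists>a n. code d m (pr i n) \<and> a \<oplus> n \<preceq> N \<and> few a n i)" for i
  proof -
    have "a \<preceq> N \<and> n \<preceq> N" if "a \<oplus> n \<preceq> N" for a n
      using that le_plus_left le_plus_right order_trans by blast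
    then show ?thesis
      unfolding I_def by blast
  qed
  have "few \<zero> N r"
    using colour by (simp add: few_def)
  moreover have "code d m (pr r N)" "\<zero> \<oplus> N \<preceq> N"
    using tower by (simp_all add: tower_def)
  ultimately have "r \<in> I"
    unfolding memI by blast
  then obtain i where i: "i \<in> I" and least: "\<And>j. j \<in> I \<Longrightarrow> i \<preceq> j"
    using least_element[OF \<open>I \<in> S\<close>] by blast
  obtain a n' where n': "code d m (pr i n')" "a \<oplus> n' \<preceq> N" "few a n' i"
    using i memI by blast
  have "n' \<preceq> N"
    using n'(2) le_plus_right order_trans by blast
  have "i \<noteq> \<zero>"
  proof
    assume "i = \<zero>"
    then have "n' \<noteq> \<zero>"
      using tower n'(1) by (auto simp: tower_def)
    then show False
      using n'(3) \<open>i = \<zero>\<close> zero_less[of n'] not_less_zero unfolding few_def by blast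
  qed
  then obtain j where j: "i = j \<oplus> \<one>"
    using nonzero_succ by blast
  have "j \<prec> r"
    using least[OF \<open>r \<in> I\<close>] by (simp add: j succ_le_iff)
  then obtain n where n: "code d m (pr j n)" "good F n n'"
    using tower n' \<open>n' \<preceq> N\<close> unfolding tower_def j by blast
  then obtain K where K: "n' = n \<otimes> K" "n \<noteq> \<zero>" "\<forall>x. x \<preceq> n \<oplus> n \<longrightarrow> (\<exists>y. y \<prec> K \<and> pr x y \<in> F)"
    unfolding good_def by blast
  have "\<exists>x. x \<prec> n \<and> pr (b \<oplus> x) j \<in> C" if "a \<preceq> b" "b \<oplus> n \<preceq> a \<oplus> n'" for b
  proof -
    have "j \<notin> I"
      using least j less_succ_iff leD by blast
    then have "\<not> few b n j"
      using memI n(1) that(2) n'(2) order_trans by blast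
    then obtain x where x: "x \<prec> n" "\<And>y. y \<prec> j \<Longrightarrow> pr (b \<oplus> x) y \<notin> C"
      by (auto simp: few_def)
    obtain u where u: "b = a \<oplus> u"
      using \<open>a \<preceq> b\<close> less_eq_iff by blast
    have "u \<oplus> x \<prec> u \<oplus> n" "u \<oplus> n \<preceq> n'"
      using x(1) that(2) by (simp_all add: u add.assoc)
    then have "u \<oplus> x \<prec> n'"
      by (rule less_le_trans)
    then obtain y where "y \<prec> i" "pr (b \<oplus> x) y \<in> C"
      using n'(3) u add.assoc unfolding few_def by metis
    moreover from this have "y = j"
      using x(2)[of y] by (auto simp: j le_less)
    ultimately show ?thesis
      using x(1) by blast
  qed
  then show ?thesis
    using n'(2) K by blast
qed

end

context RCA0_model
begin

definition increasing_with_steps :: "'a \<Rightarrow> ('a \<Rightarrow> 'a) \<Rightarrow> 'a \<Rightarrow> bool" where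
  "increasing_with_steps K h g \<longleftrightarrow> (\<forall>j k. j \<prec> k \<longrightarrow> k \<prec> K \<longrightarrow> h j \<prec> h k) \<and>
     (\<forall>j. j \<oplus> \<one> \<prec> K \<longrightarrow> h (j \<oplus> \<one>) \<preceq> h j \<oplus> g)"

text \<open>
  The element \<open>h j\<close> is the first one of the dense colour in the \<open>j\<close>-th block. So the graph of \<open>h\<close> is
  definable by a \<^const>\<open>Delta00\<close> formula and belongs to \<open>S\<close>; it is the bijection that witnesses the
  cardinality \<open>K\<close> of the homogeneous set, and no elements have to be counted.
\<close>

lemma homogeneous_enumeration:
  assumes "F \<in> S" "C \<in> S" "tower F r N (code d m)"
    and "\<And>x. x \<prec> N \<Longrightarrow> \<exists>y. y \<prec> r \<and> pr x y \<in> C"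
  shows "\<exists>h K g i. increasing_with_steps K h g \<and> \<one> \<preceq> g \<and> (\<forall>x. x \<preceq> g \<longrightarrow> (\<exists>y. y \<prec> K \<and> pr x y \<in> F))
    \<and> (\<forall>j. j \<prec> K \<longrightarrow> h j \<prec> N \<and> pr (h j) i \<in> C)
    \<and> {z. \<exists>j. j \<prec> K \<and> z = h j} \<in> S \<and> {p. \<exists>j. j \<prec> K \<and> p = pr j (h j)} \<in> S"
proof -
  obtain a n K i where inside: "a \<oplus> n \<otimes> K \<preceq> N" and n: "n \<noteq> \<zero>"
    and K: "\<And>x. x \<preceq> n \<oplus> n \<Longrightarrow> \<exists>y. y \<prec> K \<and> pr x y \<in> F"
    and dense: "\<And>b. a \<preceq> b \<Longrightarrow> b \<oplus> n \<preceq> a \<oplus> n \<otimes> K \<Longrightarrow> \<exists>x. x \<prec> n \<and> pr (b \<oplus> x) i \<in> C"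
    using dense_colour[OF assms] by blast
  define first where "first j u \<longleftrightarrow> u \<prec> n \<and> pr (a \<oplus> j \<otimes> n \<oplus> u) i \<in> C
    \<and> (\<forall>v. v \<prec> u \<longrightarrow> pr (a \<oplus> j \<otimes> n \<oplus> v) i \<notin> C)" for j u
  have block: "a \<oplus> j \<otimes> n \<oplus> n \<preceq> a \<oplus> k \<otimes> n" if "j \<prec> k" for j k
  proof -
    have "(j \<oplus> \<one>) \<otimes> n \<preceq> k \<otimes> n"
      using that by (intro mult_right_mono) (simp_all add: succ_le_iff)
    then show ?thesis
      by (simp add: distrib_right add.assoc)
  qed
  have "\<exists>u. first j u" if j: "j \<prec> K" for j
  proof -
    define U where "U = {u. pr (a \<oplus> j \<otimes> n \<oplus> u) i \<in> C}"
    have "U \<in> S"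
      unfolding U_def
      by (rule comprehension[where E = "\<lambda>_. C" and e = "case_nat a (case_nat j (case_nat n (\<lambda>_. i)))"
            and \<theta> = "Mem (pair (Add (Add (Var 1) (Mul (Var 2) (Var 3))) (Var 0)) (Var 4)) 0"])
        (use \<open>C \<in> S\<close> in auto)
    obtain x where "x \<prec> n" "x \<in> U"
      using dense[of "a \<oplus> j \<otimes> n"] block[OF j] le_plus_left
      by (auto simp: U_def mult.commute)
    moreover from this obtain u where "u \<in> U" "\<And>v. v \<in> U \<Longrightarrow> u \<preceq> v"
      using least_element[OF \<open>U \<in> S\<close>] by blast
    ultimately have "first j u"
      unfolding first_def U_def using le_less_trans leD by blast
    then show ?thesis
      by blast
  qed
  then obtain u where u: "\<And>j. j \<prec> K \<Longrightarrow> first j (u j)"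
    by metis
  have unique: "first j x \<Longrightarrow> first j y \<Longrightarrow> x = y" for j x y
    unfolding first_def using less_linear[of x y] by blast
  define h where "h j = a \<oplus> j \<otimes> n \<oplus> u j" for j
  have upper: "h j \<prec> a \<oplus> j \<otimes> n \<oplus> n" if "j \<prec> K" for j
    using u[OF that] by (simp add: h_def first_def)
  have lower: "a \<oplus> j \<otimes> n \<preceq> h j" for j
    unfolding h_def by (rule le_plus_left)
  have h: "h j \<prec> N \<and> pr (h j) i \<in> C" if "j \<prec> K" for j
  proof
    have "h j \<prec> a \<oplus> K \<otimes> n"
      using upper[OF that] block[OF that] by (rule less_le_trans)
    then show "h j \<prec> N"
      using inside by (simp add: mult.commute)
    show "pr (h j) i \<in> C"
      using u[OF that] by (simp add: first_def h_def)
  qed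
  have incr: "increasing_with_steps K h (n \<oplus> n)"
    unfolding increasing_with_steps_def
  proof (intro conjI allI impI)
    show "h j \<prec> h k" if "j \<prec> k" "k \<prec> K" for j k
      using upper[of j] block[of j k] lower[of k] that less_trans less_le_trans by blast
  next
    fix j
    assume j: "j \<oplus> \<one> \<prec> K"
    have "h (j \<oplus> \<one>) \<preceq> a \<oplus> (j \<oplus> \<one>) \<otimes> n \<oplus> n"
      using upper[OF j] by (rule less_imp_le)
    also have "\<dots> = a \<oplus> j \<otimes> n \<oplus> (n \<oplus> n)"
      by (simp add: algebra_simps)
    also have "\<dots> \<preceq> h j \<oplus> (n \<oplus> n)"
      using lower by (intro add_right_mono)
    finally show "h (j \<oplus> \<one>) \<preceq> h j \<oplus> (n \<oplus> n)" .
  qed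
  define B where "B = {p. \<exists>j. j \<prec> K \<and> (\<exists>z. z \<prec> N \<and> p = pr j z \<and> (\<exists>v. v \<prec> n \<and> z = a \<oplus> j \<otimes> n \<oplus> v
    \<and> pr z i \<in> C \<and> (\<forall>w. w \<prec> v \<longrightarrow> pr (a \<oplus> j \<otimes> n \<oplus> w) i \<notin> C)))}"
  have "B \<in> S"
    unfolding B_def
    by (rule comprehension[where E = "\<lambda>_. C"
          and e = "case_nat a (case_nat n (case_nat K (case_nat i (\<lambda>_. N))))"
          and \<theta> = "BEx (Var 3) (BEx (Var 6) (And (Eq (Var 2) (pair (Var 1) (Var 0)))
            (BEx (Var 4) (And (Eq (Var 1) (Add (Add (Var 4) (Mul (Var 2) (Var 5))) (Var 0)))
              (And (Mem (pair (Var 1) (Var 7)) 0)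
                (BAll (Var 0) (Neg (Mem (pair (Add (Add (Var 5) (Mul (Var 3) (Var 6))) (Var 0)) (Var 8)) 0))))))))"])
      (use \<open>C \<in> S\<close> in auto)
  moreover have B: "B = {p. \<exists>j. j \<prec> K \<and> p = pr j (h j)}"
  proof -
    have "(\<exists>z. z \<prec> N \<and> p = pr j z \<and> (\<exists>v. v \<prec> n \<and> z = a \<oplus> j \<otimes> n \<oplus> v
        \<and> pr z i \<in> C \<and> (\<forall>w. w \<prec> v \<longrightarrow> pr (a \<oplus> j \<otimes> n \<oplus> w) i \<notin> C))) \<longleftrightarrow> p = pr j (h j)" (is "?L \<longleftrightarrow> ?R")
      if "j \<prec> K" for j p
    proof
      assume ?L
      then obtain v where "p = pr j (a \<oplus> j \<otimes> n \<oplus> v)" "first j v"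
        unfolding first_def by blast
      then show ?R
        using unique u[OF that] by (auto simp: h_def)
    next
      assume ?R
      then show ?L
        using h[OF that] u[OF that] unfolding first_def h_def by blast
    qed
    then show ?thesis
      unfolding B_def by blast
  qed
  moreover have "{z. \<exists>j. j \<prec> K \<and> z = h j} \<in> S"
    by (rule comprehension[where E = "\<lambda>_. B" and e = "\<lambda>_. K"
          and \<theta> = "BEx (Var 1) (Mem (pair (Var 0) (Var 1)) 0)"])
      (use \<open>B \<in> S\<close> in \<open>auto simp: B\<close>)
  moreover have "\<one> \<preceq> n \<oplus> n"
    using n nonzero_succ le_plus_right add.assoc by metis
  ultimately show ?thesis
    using incr K h by blast
qed

definition consecutive_in :: "'a set \<Rightarrow> 'a \<Rightarrow> 'a \<Rightarrow> bool" where
  "consecutive_in H u v \<longleftrightarrow> u \<in> H \<and> v \<in> H \<and> u \<prec> v \<and> \<not> (\<exists>z. z \<in> H \<and> u \<prec> z \<and> z \<prec> v)"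

text \<open>
  The gap size is the least \<open>s\<close> that bounds all gaps. If \<open>u = h j\<close> and \<open>v\<close> are
  consecutive elements of \<open>H\<close>, then \<open>v \<le> h (j + 1) \<le> u + g\<close>, so \<open>g\<close> is a bound. The least bound is positive because \<open>h 0\<close> and \<open>h 1\<close> are
  consecutive, and it is attained because its predecessor is not a bound.
\<close>

lemma gap_size_exists:
  assumes "increasing_with_steps K h g" and H: "H = {z. \<exists>j. j \<prec> K \<and> z = h j}"
    and "H \<in> S" "\<And>j. j \<prec> K \<Longrightarrow> h j \<prec> N" "\<one> \<prec> K"
  shows "\<exists>s. s \<preceq> g \<and> (\<exists>u. consecutive_in H u (u \<oplus> s)) \<and> (\<forall>u v. consecutive_in H u v \<longrightarrow> v \<preceq> u \<oplus> s)"
proof -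
  have incr: "j \<prec> k \<Longrightarrow> k \<prec> K \<Longrightarrow> h j \<prec> h k" and gap: "j \<oplus> \<one> \<prec> K \<Longrightarrow> h (j \<oplus> \<one>) \<preceq> h j \<oplus> g" for j k
    using assms(1) by (auto simp: increasing_with_steps_def)
  have "h \<zero> \<prec> h \<one>"
    using \<open>\<one> \<prec> K\<close> by (intro incr) auto
  moreover have "\<not> (h \<zero> \<prec> h k \<and> h k \<prec> h \<one>)" if "k \<prec> K" for k
  proof (cases "k = \<zero>")
    case False
    then consider "k = \<one>" | "\<one> \<prec> k"
      using succ_le_iff[of \<zero> k] by (auto simp: le_less)
    then show ?thesis
      using incr[of \<one> k] that by cases (auto dest: less_asym)
  qed simp
  moreover have "\<zero> \<prec> K"
    using \<open>\<one> \<prec> K\<close> by auto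
  ultimately have first_two: "consecutive_in H (h \<zero>) (h \<one>)"
    using \<open>\<one> \<prec> K\<close> unfolding consecutive_in_def H by blast
  define G where "G = {s. \<forall>u. u \<prec> N \<longrightarrow> (\<forall>v. v \<prec> N \<longrightarrow> u \<in> H \<and> v \<in> H \<and> u \<prec> v
    \<and> (\<forall>z. z \<prec> v \<longrightarrow> z \<in> H \<longrightarrow> \<not> u \<prec> z) \<longrightarrow> v \<preceq> u \<oplus> s)}"
  have "G \<in> S"
    unfolding G_def
    by (rule comprehension[where E = "\<lambda>_. H" and e = "\<lambda>_. N"
          and \<theta> = "BAll (Var 1) (BAll (Var 2) (Imp
            (And (Mem (Var 1) 0) (And (Mem (Var 0) 0) (And (Less (Var 1) (Var 0))
              (BAll (Var 0) (Imp (Mem (Var 0) 0) (Neg (Less (Var 2) (Var 0))))))))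
            (Less (Var 0) (Add (Add (Var 1) (Var 2)) One))))"])
      (use \<open>H \<in> S\<close> in auto)
  have G: "s \<in> G \<longleftrightarrow> (\<forall>u v. consecutive_in H u v \<longrightarrow> v \<preceq> u \<oplus> s)" for s
  proof -
    have "u \<prec> N" if "u \<in> H" for u
      using that assms(4) H by blast
    then show ?thesis
      unfolding G_def consecutive_in_def by blast
  qed
  have "g \<in> G"
    unfolding G
  proof (intro allI impI)
    fix u v
    assume uv: "consecutive_in H u v"
    then obtain j k where j: "j \<prec> K" "u = h j" and k: "k \<prec> K" "v = h k"
      unfolding consecutive_in_def H by blast
    have "u \<prec> v"
      using uv by (simp add: consecutive_in_def)
    then have "j \<prec> k"
      using incr[of k j] j k less_linear[of j k] less_asym by blast
    then have "j \<oplus> \<one> \<prec> K"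
      using k(1) succ_le_iff le_less_trans by blast
    moreover from this have "h (j \<oplus> \<one>) \<in> H" "u \<prec> h (j \<oplus> \<one>)"
      using incr[of j "j \<oplus> \<one>"] j H by auto
    then have "v \<preceq> h (j \<oplus> \<one>)"
      using uv unfolding consecutive_in_def by (meson not_le)
    ultimately show "v \<preceq> u \<oplus> g"
      using gap j(2) order_trans by blast
  qed
  then obtain s where s: "s \<in> G" and least: "\<And>t. t \<in> G \<Longrightarrow> s \<preceq> t"
    using least_element[OF \<open>G \<in> S\<close>] by blast
  have "s \<noteq> \<zero>"
    using first_two \<open>h \<zero> \<prec> h \<one>\<close> s unfolding G by fastforce
  then obtain t where t: "s = t \<oplus> \<one>"
    using nonzero_succ by blast
  then have "\<not> s \<preceq> t"
    by (simp add: not_le)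
  then have "t \<notin> G"
    using least by blast
  then obtain u v where uv: "consecutive_in H u v" "u \<oplus> t \<prec> v"
    unfolding G using not_le by blast
  then have "u \<oplus> s \<preceq> v"
    by (simp add: t succ_le_iff flip: add.assoc)
  moreover have "v \<preceq> u \<oplus> s"
    using s uv(1) unfolding G by blast
  ultimately have "consecutive_in H u (u \<oplus> s)"
    using uv(1) order_antisym by metis
  then show ?thesis
    using s least[OF \<open>g \<in> G\<close>] unfolding G by blast
qed

end

section \<open>Truth of the finite Brown lemma in a model\<close>

context RCA0_model
begin

text \<open>
  The following predicates are the meanings of the formulas with similar names.
\<close>

definition function_on :: "'a set \<Rightarrow> ('a \<Rightarrow> bool) \<Rightarrow> ('a \<Rightarrow> bool) \<Rightarrow> bool" where
  "function_on F P Q \<longleftrightarrow> (\<forall>p\<in>F. \<exists>x y. P x \<and> Q y \<and> pr x y = p)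
     \<and> (\<forall>x y z. pr x y \<in> F \<longrightarrow> pr x z \<in> F \<longrightarrow> z = y)
     \<and> (\<forall>x. P x \<longrightarrow> (\<exists>y. pr x y \<in> F))"

definition has_card :: "'a set \<Rightarrow> 'a \<Rightarrow> bool" where
  "has_card H c \<longleftrightarrow> (\<exists>B\<in>S. function_on B (\<lambda>x. x \<prec> c) (\<lambda>y. y \<in> H)
     \<and> (\<forall>x y z. pr x z \<in> B \<longrightarrow> pr y z \<in> B \<longrightarrow> x = y) \<and> (\<forall>z. z \<in> H \<longrightarrow> (\<exists>x. pr x z \<in> B)))"

definition has_gap_size :: "'a set \<Rightarrow> 'a \<Rightarrow> bool" where
  "has_gap_size H s \<longleftrightarrow> (\<exists>c. has_card H c \<and> c \<preceq> \<one>) \<and> s = \<one>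
     \<or> (\<exists>c. has_card H c \<and> \<one> \<prec> c) \<and> (\<exists>u. consecutive_in H u (u \<oplus> s))
       \<and> (\<forall>u v. consecutive_in H u v \<longrightarrow> v \<preceq> u \<oplus> s)"

lemma sat_in_class: "sat e E (in_class k s A) \<longleftrightarrow> sat (case_nat (eval e s) (\<lambda>i. e (i + k))) E A"
proof -
  have "(\<lambda>i. eval e (case_nat s (\<lambda>i. Var (i + k)) i)) = case_nat (eval e s) (\<lambda>i. e (i + k))"
    by (auto simp: fun_eq_iff split: nat.split)
  then show ?thesis
    by (simp add: in_class_def sat_subst)
qed

lemma sat_is_function:
  "sat e E (is_function F A B) \<longleftrightarrow>
     function_on (E F) (\<lambda>x. sat (case_nat x e) E A) (\<lambda>y. sat (case_nat y e) E B)"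
proof -
  have "(\<lambda>i. case_nat x (case_nat y (case_nat z e)) (i + 3)) = e" for x y z
    by (simp add: numeral_3_eq_3)
  moreover have "(\<lambda>i. case_nat x e (i + 1)) = e" for x
    by (simp add: One_nat_def)
  ultimately show ?thesis
    by (simp add: is_function_def function_on_def sat_in_class) blast
qed

lemma sat_card_is: "sat e E (card_is H c) \<longleftrightarrow> has_card (E H) (eval e c)"
  by (simp add: card_is_def has_card_def sat_is_function below_def elements_def) blast

lemma sat_consecutive: "sat e E (consecutive H a b) \<longleftrightarrow> consecutive_in (E H) (eval e a) (eval e b)"
  by (simp add: consecutive_def consecutive_in_def) blast

lemma sat_gap_size_is: "sat e E (gap_size_is H g) \<longleftrightarrow> has_gap_size (E H) (eval e g)"
  by (auto simp: gap_size_is_def has_gap_size_def sat_card_is sat_consecutive le_less)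

lemma enumeration_card:
  assumes "increasing_with_steps K h g" "{p. \<exists>j. j \<prec> K \<and> p = pr j (h j)} \<in> S"
  shows "has_card {z. \<exists>j. j \<prec> K \<and> z = h j} K"
proof -
  have "j = k" if "h j = h k" "j \<prec> K" "k \<prec> K" for j k
    using assms(1) that less_linear[of j k] less_irrefl unfolding increasing_with_steps_def by metis
  then show ?thesis
    unfolding has_card_def function_on_def by (intro bexI[OF _ assms(2)]) auto
qed

definition large_homogeneous_set :: "'a set \<Rightarrow> 'a set \<Rightarrow> 'a \<Rightarrow> 'a set \<Rightarrow> bool" where
  "large_homogeneous_set F C n H \<longleftrightarrow> (\<forall>z. z \<in> H \<longrightarrow> z \<prec> n)
     \<and> (\<forall>x. x \<in> H \<longrightarrow> (\<forall>y. y \<in> H \<longrightarrow> (\<forall>u. pr x u \<in> C \<longrightarrow> (\<forall>v. pr y v \<in> C \<longrightarrow> u = v))))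
     \<and> (\<exists>s. has_gap_size H s \<and> (\<exists>m. pr s m \<in> F \<and> (\<exists>c. has_card H c \<and> m \<prec> c)))"

lemma sat_finite_Brown:
  "sat e E finite_Brown \<longleftrightarrow> (\<forall>F\<in>S. function_on F (\<lambda>_. True) (\<lambda>_. True) \<longrightarrow> (\<forall>r. r \<noteq> \<zero> \<longrightarrow>
     (\<exists>n. \<forall>C\<in>S. function_on C (\<lambda>x. x \<prec> n) (\<lambda>y. y \<prec> r) \<longrightarrow> (\<exists>H\<in>S. large_homogeneous_set F C n H))))"
  by (simp add: finite_Brown_def Let_def sat_is_function all_numbers_def below_def subset_below_def
      homogeneous_def card_exceeds_def sat_gap_size_is sat_card_is large_homogeneous_set_def)

text \<open>
  If \<open>K \<le> 1\<close>, the gap size is 1 by convention and still at most \<open>g\<close>; hence in both cases the value of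
  \<open>F\<close> at the gap size is below the cardinality \<open>K\<close>.
\<close>

lemma large_homogeneous_set_exists:
  assumes F: "F \<in> S" "tower F r N (code d m)"
    and C: "C \<in> S" "function_on C (\<lambda>x. x \<prec> N) (\<lambda>y. y \<prec> r)"
  shows "\<exists>H\<in>S. large_homogeneous_set F C N H"
proof -
  have "\<exists>y. y \<prec> r \<and> pr x y \<in> C" if "x \<prec> N" for x
    using C(2) that unfolding function_on_def by (metis pr_inject)
  then obtain h K g i where h: "increasing_with_steps K h g" "\<one> \<preceq> g"
      "\<And>x. x \<preceq> g \<Longrightarrow> \<exists>y. y \<prec> K \<and> pr x y \<in> F"
      "\<And>j. j \<prec> K \<Longrightarrow> h j \<prec> N" "\<And>j. j \<prec> K \<Longrightarrow> pr (h j) i \<in> C"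
    and sets: "{z. \<exists>j. j \<prec> K \<and> z = h j} \<in> S" "{p. \<exists>j. j \<prec> K \<and> p = pr j (h j)} \<in> S"
    using homogeneous_enumeration[OF F(1) C(1) F(2)] by blast
  define H where "H = {z. \<exists>j. j \<prec> K \<and> z = h j}"
  have "H \<in> S"
    using sets(1) by (simp add: H_def)
  have card: "has_card H K"
    unfolding H_def using h(1) sets(2) by (rule enumeration_card)
  have "\<exists>s. s \<preceq> g \<and> has_gap_size H s"
  proof (cases "\<one> \<prec> K")
    case True
    then show ?thesis
      using gap_size_exists[OF h(1) H_def \<open>H \<in> S\<close> h(4)] card unfolding has_gap_size_def by blast
  next
    case False
    then show ?thesis
      using card h(2) unfolding has_gap_size_def not_less by blast
  qed
  then obtain s y where "has_gap_size H s" "y \<prec> K" "pr s y \<in> F"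
    using h(3) by blast
  moreover have "u = v" if "x \<in> H" "y \<in> H" "pr x u \<in> C" "pr y v \<in> C" for x y u v
  proof -
    have "pr x i \<in> C" "pr y i \<in> C"
      using that(1,2) h(5) by (auto simp: H_def)
    then show ?thesis
      using that(3,4) C(2) unfolding function_on_def by metis
  qed
  moreover have "\<forall>z. z \<in> H \<longrightarrow> z \<prec> N"
    using h(4) by (auto simp: H_def)
  ultimately have "large_homogeneous_set F C N H"
    unfolding large_homogeneous_set_def using card by blast
  then show ?thesis
    using \<open>H \<in> S\<close> by blast
qed

theorem finite_Brown_true: "sat e E finite_Brown"
  unfolding sat_finite_Brown
proof (intro ballI impI allI)
  fix F r
  assume F: "F \<in> S" "function_on F (\<lambda>_. True) (\<lambda>_. True)"
  then obtain N d m where "tower F r N (code d m)"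
    using tower_exists[of F r] unfolding function_on_def by blast
  then show "\<exists>n. \<forall>C\<in>S. function_on C (\<lambda>x. x \<prec> n) (\<lambda>y. y \<prec> r) \<longrightarrow> (\<exists>H\<in>S. large_homogeneous_set F C n H)"
    using large_homogeneous_set_exists F(1) by blast
qed

end

lemma finite_Brown_closed: "free_below 0 0 finite_Brown"
  by (simp add: finite_Brown_def Let_def is_function_def in_class_def all_numbers_def below_def
      subset_below_def homogeneous_def card_exceeds_def gap_size_is_def card_is_def consecutive_def
      elements_def pair_def shift_tm_def One_nat_def)

theorem theorem6p2: "RCA0 \<turnstile> finite_Brown"
proof (rule ccontr)
  assume "\<not> RCA0 \<turnstile> finite_Brown"
  then obtain zero one plus times less and S :: "nat set set" and e E
    where "RCA0_model zero one plus times less S"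
      and "\<not> arith_structure.sat zero one plus times less S e E finite_Brown"
    using countermodel[OF _ finite_Brown_closed] by metis
  then show False
    using RCA0_model.finite_Brown_true by metis
qed

end
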